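(* Consider the stochastic dynamical network $x_{t+1}=(I-hL_{x_t})x_t+hw_t$, $t\in\mathbb{Z}_+$, on $\Delta^\perp$ described in the context. Suppose that (1) the coupling function $\phi$ is positive, continuous on $[0,\infty)$, differentiable at zero, and bounded above by some $S_0>0$; (2) the graph $\mathcal{G}_0$ on $\{1,\dots,n\}$, in which $i$ and $j$ are joined by an edge if and only if $k_{ij}>0$, is undirected, simple and connected; (3) the dynamics is uniformly contractive on $\Delta^\perp$, i.e. $\lambda_{\max}(L_{x_t})<2/h$ along all trajectories of the system, so that $$\zeta:=\sup_{t\ge 0}\max\{|1-h\lambda_2(L_{x_t})|,\ |1-h\lambda_{\max}(L_{x_t})|\}<1 .$$ Then the stochastic process $\{x_t\}_{t\ge0}$ in $\Delta^\perp$ generated by this network is geometrically ergodic.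
   Context: Network. Fix integers $n,d\ge1$, a sampling time $h>0$, coefficients $k_{ij}\ge0$ ($1\le i,j\le n$) and a coupling function $\phi:\mathbb{R}\to\mathbb{R}$. The original network is $$x^i_{t+1}=x^i_t+h\sum_{j=1}^n k_{ij}\,\phi(\|x^j_t-x^i_t\|)(x^j_t-x^i_t)+hw^i_t,\qquad x_t^i,w_t^i\in\mathbb{R}^d .$$ With $x_t=[x^1_t;\dots;x^n_t]$ and $w_t=[w_t^1;\dots;w_t^n]$ in $\mathbb{R}^{dn}$ it reads $x_{t+1}=(I-hL_{x_t})x_t+hw_t$, where the state-dependent Laplacian $L_x$ has $d\times d$ blocks $(L_x)_{ij}=-k_{ij}\phi(\|x^j-x^i\|)I_d$ for $j\ne i$ and $(L_x)_{ii}=\sum_{k}k_{ik}\phi(\|x^k-x^i\|)I_d$. Initial condition and noise. The initial condition $x_0$ has bounded i.i.d. entries and $\|x_0\|\le R_0$ almost surely. The noises $w_t$, $t\ge0$, are i.i.d. in $t$ with bounded i.i.d. entries, $w_t$ is independent of $x_t$, and $\mathbb{E}[w_t]=0$, $\mathbb{E}[w_tw_t^T]=I\otimes\Sigma$, $\|w_t\|\le\omega$ almost surely for some constant $\omega>0$. The distribution of $w_t$ has a lower semicontinuous density with respect to Lebesgue measure. Restriction to $\Delta^\perp$. Let $\Delta=\{[u;\dots;u]: u\in\mathbb{R}^d\}\subset\mathbb{R}^{dn}$ and let $\Delta^\perp$ be its orthogonal complement. The orthogonal projections of $x_t$ and $w_t$ onto $\Delta^\perp$ again satisfy $x_{t+1}=(I-hL_{x_t})x_t+hw_t$.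 In the claim, $x_t$ and $w_t$ denote these projections, so $x_t,w_t\in\Delta^\perp$ and $\mathbb{E}[w_tw_t^T]=M_n\otimes\Sigma$ with $M_n=I-\frac1n\mathbf{1}\mathbf{1}^T$. $\lambda_2(L_x)$ and $\lambda_{\max}(L_x)$ denote the smallest non-zero and the largest eigenvalue of $L_x$. Geometric ergodicity. Let $\mathcal{X}\subset\Delta^\perp$ be the state space of the chain (the set in which its trajectories take their values) and let $\mathbb{P}^t(x,A)=\mathbb{P}(x_t\in A\mid x_0=x)$ for $x\in\mathcal{X}$ and Borel $A$. The process $\{x_t\}$ is geometrically ergodic if there exist a probability measure $\pi$ on the Borel sets of the state space, a number $0<\rho<1$, and a $\pi$-integrable nonnegative measurable function $g$ on the state space such that $$\|\mathbb{P}^t(x,\cdot)-\pi(\cdot)\|_{TV}:=\sup_{A}|\mathbb{P}^t(x,A)-\pi(A)|\le\rho^t g(x)$$ for all $x\in\mathcal{X}$ and $t\ge0$. *)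

theory Defs
  imports "HOL-Probability.Probability"
begin

text \<open>
  The \<open>n\<close> agents are the elements of the finite type \<^typ>\<open>'n\<close>, the \<open>d\<close> coordinates those of \<^typ>\<open>'d\<close>;
  a stacked vector \<open>[x\<^sup>1; \<dots>; x\<^sup>n]\<close> is indexed by pairs (agent, coordinate).
\<close>

type_synonym ('n, 'd) state = "real ^ ('n \<times> 'd)"

definition agent :: "('n::finite, 'd::finite) state \<Rightarrow> 'n \<Rightarrow> real ^ 'd" where
  "agent x i = (\<chi> a. x $ (i, a))"

definition kron :: "real ^ 'n ^ 'n \<Rightarrow> real ^ 'd ^ 'd \<Rightarrow> real ^ ('n::finite \<times> 'd::finite) ^ ('n \<times> 'd)" where
  "kron A B = (\<chi> p q. A $ fst p $ fst q * B $ snd p $ snd q)"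

definition laplacian ::
  "('n \<Rightarrow> 'n \<Rightarrow> real) \<Rightarrow> (real \<Rightarrow> real) \<Rightarrow> ('n::finite, 'd::finite) state
    \<Rightarrow> real ^ ('n \<times> 'd) ^ ('n \<times> 'd)" where
  "laplacian k \<phi> x = (\<chi> p q.
     let i = fst p; j = fst q in
     (if i = j then (\<Sum>l\<in>UNIV. k i l * \<phi> (norm (agent x l - agent x i)))
      else - k i j * \<phi> (norm (agent x j - agent x i))) * (mat 1 :: real ^ 'd ^ 'd) $ snd p $ snd q)"

definition eigenvalues :: "real ^ 'm ^ 'm \<Rightarrow> real set" where
  "eigenvalues A = {l. \<exists>v. v \<noteq> 0 \<and> A *v v = l *\<^sub>R v}"

definition lambda_max :: "real ^ 'm ^ 'm \<Rightarrow> real" where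
  "lambda_max A = Max (eigenvalues A)"

definition lambda_2 :: "real ^ 'm ^ 'm \<Rightarrow> real" where
  "lambda_2 A = Min (eigenvalues A - {0})"

definition interaction_graph :: "('n \<Rightarrow> 'n \<Rightarrow> real) \<Rightarrow> 'n rel" where
  "interaction_graph k = {(i, j). k i j > 0}"

text \<open>The state at time \<open>t\<close> as a function of the initial state and the noise sequence.\<close>

primrec network ::
  "real \<Rightarrow> ('n \<Rightarrow> 'n \<Rightarrow> real) \<Rightarrow> (real \<Rightarrow> real) \<Rightarrow> ('n::finite, 'd::finite) state
    \<Rightarrow> (nat \<Rightarrow> ('n, 'd) state) \<Rightarrow> nat \<Rightarrow> ('n, 'd) state" where
  "network h k \<phi> x w 0 = x"
| "network h k \<phi> x w (Suc t) =
     (mat 1 - h *\<^sub>R laplacian k \<phi> (network h k \<phi> x w t)) *v network h k \<phi> x w t + h *\<^sub>R w t"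

definition consensus :: "('n::finite, 'd::finite) state set" where
  "consensus = {x. \<exists>u. \<forall>i. agent x i = u}"

text \<open>On the subspace \<open>consensus\<^sup>\<bottom>\<close> the nearest point is the orthogonal projection.\<close>

definition disagreement :: "('n::finite, 'd::finite) state \<Rightarrow> ('n, 'd) state" where
  "disagreement x = closest_point (consensus\<^sup>\<bottom>) x"

definition lower_semicontinuous :: "('a::topological_space \<Rightarrow> real) \<Rightarrow> bool" where
  "lower_semicontinuous f \<longleftrightarrow> (\<forall>c. open {x. c < f x})"

definition iid :: "'a measure \<Rightarrow> ('i \<Rightarrow> 'a \<Rightarrow> 'b::topological_space) \<Rightarrow> bool" where
  "iid M X \<longleftrightarrow> prob_space.indep_vars M (\<lambda>_. borel) X UNIV \<and>
     (\<forall>i j. distr M borel (X i) = distr M borel (X j))"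

definition msupp :: "'a::topological_space measure \<Rightarrow> 'a set" where
  "msupp \<mu> = {x. \<forall>U. open U \<and> x \<in> U \<longrightarrow> emeasure \<mu> U > 0}"

text \<open>
  The trajectories on \<open>consensus\<^sup>\<bottom>\<close> start in the support of the law of the projected initial
  condition \<open>x0\<close> and are driven by noise values in the support of the law of the projected noise.
  Working with supports, null sets of outcomes do not influence the set of trajectories.
\<close>

definition trajectories ::
  "'a measure \<Rightarrow> real \<Rightarrow> ('n \<Rightarrow> 'n \<Rightarrow> real) \<Rightarrow> (real \<Rightarrow> real) \<Rightarrow> ('a \<Rightarrow> ('n::finite, 'd::finite) state)
    \<Rightarrow> (nat \<Rightarrow> 'a \<Rightarrow> ('n, 'd) state) \<Rightarrow> (nat \<Rightarrow> ('n, 'd) state) set" where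
  "trajectories M h k \<phi> x0 w =
     {network h k \<phi> x v | x v.
        x \<in> msupp (distr M borel (\<lambda>\<omega>. disagreement (x0 \<omega>))) \<and>
        (\<forall>t. v t \<in> msupp (distr M borel (\<lambda>\<omega>. disagreement (w t \<omega>))))}"

definition state_space ::
  "'a measure \<Rightarrow> real \<Rightarrow> ('n \<Rightarrow> 'n \<Rightarrow> real) \<Rightarrow> (real \<Rightarrow> real) \<Rightarrow> ('a \<Rightarrow> ('n::finite, 'd::finite) state)
    \<Rightarrow> (nat \<Rightarrow> 'a \<Rightarrow> ('n, 'd) state) \<Rightarrow> ('n, 'd) state set" where
  "state_space M h k \<phi> x0 w = {x t | x t. x \<in> trajectories M h k \<phi> x0 w}"

text \<open>
  The law \<open>\<P>\<^sup>t(x, \<cdot>)\<close> of the projected network at time \<open>t\<close> when it starts at the fixed state \<open>x\<close>.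
\<close>

definition transition ::
  "'a measure \<Rightarrow> real \<Rightarrow> ('n \<Rightarrow> 'n \<Rightarrow> real) \<Rightarrow> (real \<Rightarrow> real)
    \<Rightarrow> (nat \<Rightarrow> 'a \<Rightarrow> ('n::finite, 'd::finite) state)
    \<Rightarrow> nat \<Rightarrow> ('n, 'd) state \<Rightarrow> ('n, 'd) state measure" where
  "transition M h k \<phi> w t x =
     distr M borel (\<lambda>\<omega>. network h k \<phi> x (\<lambda>s. disagreement (w s \<omega>)) t)"

definition geometrically_ergodic ::
  "'s::topological_space set \<Rightarrow> (nat \<Rightarrow> 's \<Rightarrow> 's measure) \<Rightarrow> bool" where
  "geometrically_ergodic S P \<longleftrightarrow>
     (\<exists>\<pi> \<rho> g. prob_space \<pi> \<and> sets \<pi> = sets (restrict_space borel S) \<and>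
        0 < \<rho> \<and> \<rho> < 1 \<and>
        integrable \<pi> g \<and> (\<forall>x\<in>S. 0 \<le> g x) \<and>
        (\<forall>x\<in>S. \<forall>t. (SUP A\<in>sets (restrict_space borel S). \<bar>measure (P t x) A - measure \<pi> A\<bar>)
                     \<le> \<rho> ^ t * (g x :: real)))"

end

theory Submission
  imports Defs
begin

text \<open>
  On the state space the drift \<open>y \<mapsto> (I - h L\<^sub>y) y\<close> satisfies \<open>norm (drift y) \<le> c * norm y\<close> with
  \<open>c < 1\<close>, because the norm of \<open>I - h L\<^sub>y\<close> on \<open>consensus\<^sup>\<bottom>\<close> is attained at an eigenvector of the
  Laplacian with a non-zero eigenvalue. Hence the state space is bounded. As the agents' noises are
  i.i.d., \<open>0\<close> lies in the support of the projected noise; with small noise the contraction brings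
  the chain into any given ball around \<open>0\<close> in a number of steps, and with a probability, that do not
  depend on the starting point. One more step from that ball spreads a fixed multiple of the projected
  Lebesgue measure of some ball, because a lower semicontinuous density is bounded below near a point
  where it is positive. Thus some iterate of the transition kernel dominates a fixed non-zero
  measure, uniformly over the state space, and Doeblin's criterion applies.
\<close>

section \<open>Doeblin's criterion\<close>

text \<open>Contraction is assumed only along trajectories, so every estimate has to be made on a
  set that the chain never leaves. Taking supports of the laws makes the set of reached states such
  a set: it is forward invariant and carries all the mass of every transition law started in it. It
  is a countable union of compact sets, possibly not closed, so the invariant measure is obtained as
  a setwise limit of probabilities.

  The second obstacle is that the noise density lives on the whole space of stacked vectors, while
  the chain lives on a proper subspace, which is Lebesgue null. No density on the subspace is
  constructed. As \<open>drift y\<close> already lies in the subspace, projecting the unprojected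
  step \<open>drift y + h *\<^sub>R u\<close> gives the projected one; so a lower bound by Lebesgue
  measure on a ball is proved in the whole space and pushed forward by \<open>disagreement\<close>.
  Starting that step near \<open>0\<close> allows one ball to serve all \<open>y\<close>, which
  frees the minorizing measure of the starting point.\<close>

lemma AE_minorizing:
  assumes "finite_measure P" and "finite_measure \<nu>" and sets: "sets \<nu> = sets P"
    and minor: "\<And>A. A \<in> sets P \<Longrightarrow> measure \<nu> A \<le> measure P A"
    and "AE y in P. Q y"
  shows "AE y in \<nu>. Q y"
proof -
  interpret P: finite_measure P by fact
  interpret N: finite_measure \<nu> by fact
  obtain N where N: "N \<in> null_sets P" "{x\<in>space P. \<not> Q x} \<subseteq> N"
    using \<open>AE y in P. Q y\<close> by (auto simp: eventually_ae_filter)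
  then have "N \<in> null_sets \<nu>"
    using minor[of N] sets
    by (auto simp: null_sets_def P.emeasure_eq_measure N.emeasure_eq_measure measure_le_0_iff)
  then show ?thesis
    using N(2) sets_eq_imp_space_eq[OF sets] by (auto simp: eventually_ae_filter)
qed

text \<open>For finite measures the setwise bound is the order \<open>\<nu> \<le> P\<close>, under
  which nonnegative integrals are monotone. The bound \<open>b\<close> provides the integrability
  that turns them into Lebesgue integrals.\<close>

lemma integral_minorizing_le:
  fixes u :: "'s \<Rightarrow> real"
  assumes P: "finite_measure P" and \<nu>: "finite_measure \<nu>" and sets: "sets \<nu> = sets P"
    and minor: "\<And>A. A \<in> sets P \<Longrightarrow> measure \<nu> A \<le> measure P A"
    and u: "u \<in> borel_measurable P" "AE y in P. 0 \<le> u y" "AE y in P. u y \<le> b"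
  shows "(\<integral>y. u y \<partial>\<nu>) \<le> (\<integral>y. u y \<partial>P)"
proof -
  interpret P: finite_measure P by fact
  interpret N: finite_measure \<nu> by fact
  have AE: "AE y in \<nu>. Q y" if "AE y in P. Q y" for Q
    by (rule AE_minorizing[OF P \<nu> sets minor that])
  have "integrable P u"
    by (rule P.integrable_const_bound[where B=b]) (use u in auto)
  moreover have "integrable \<nu> u"
    by (rule N.integrable_const_bound[where B=b])
      (use AE[OF u(2)] AE[OF u(3)] measurable_cong_sets[OF sets refl, of borel] u(1) in auto)
  moreover have "(\<integral>\<^sup>+ y. u y \<partial>\<nu>) \<le> (\<integral>\<^sup>+ y. u y \<partial>P)"
  proof (rule nn_integral_mono_measure)
    have "emeasure \<nu> A \<le> emeasure P A" for A
    proof (cases "A \<in> sets P")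
      case True
      then show ?thesis
        unfolding P.emeasure_eq_measure N.emeasure_eq_measure by (intro ennreal_leI minor)
    next
      case False
      then show ?thesis using sets by (simp add: emeasure_notin_sets)
    qed
    then show "\<nu> \<le> P"
      unfolding le_measure_iff le_fun_def using sets sets_eq_imp_space_eq[OF sets] by simp
  qed (use sets in auto)
  ultimately have "ennreal (\<integral>y. u y \<partial>\<nu>) \<le> ennreal (\<integral>y. u y \<partial>P)"
    using u(2) AE[OF u(2)] by (simp add: nn_integral_eq_integral)
  then show ?thesis
    using integral_nonneg_AE[OF u(2)] by simp
qed

text \<open>Morally \<open>P - \<nu>\<close> and \<open>Q - \<nu>\<close> are positive measures of
  mass \<open>1 - \<nu>(space \<nu>)\<close>, and the common part \<open>\<nu>\<close> cancels in
  the difference. Difference measures are avoided by comparing the nonnegative functions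
  \<open>b - u\<close> under \<open>P\<close> and \<open>u - a\<close> under \<open>Q\<close> with
  their integrals under \<open>\<nu>\<close>.\<close>

lemma integral_diff_minorizing_le:
  fixes u :: "'s \<Rightarrow> real"
  assumes P: "prob_space P" and Q: "prob_space Q" and \<nu>: "finite_measure \<nu>"
    and sets: "sets P = sets \<nu>" "sets Q = sets \<nu>"
    and minor: "\<And>A. A \<in> sets \<nu> \<Longrightarrow> measure \<nu> A \<le> measure P A" "\<And>A. A \<in> sets \<nu> \<Longrightarrow> measure \<nu> A \<le> measure Q A"
    and u: "u \<in> borel_measurable \<nu>" 
    and bnd: "AE y in P. a \<le> u y" "AE y in P. u y \<le> b" "AE y in Q. a \<le> u y" "AE y in Q. u y \<le> b"
  shows "(\<integral>y. u y \<partial>P) - (\<integral>y. u y \<partial>Q) \<le> (1 - measure \<nu> (space \<nu>)) * (b - a)"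
proof -
  interpret P: prob_space P by fact
  interpret Q: prob_space Q by fact
  interpret N: finite_measure \<nu> by fact
  have uP: "u \<in> borel_measurable P" and uQ: "u \<in> borel_measurable Q"
    using u sets by (auto cong: measurable_cong_sets)
  have AE: "AE y in \<nu>. R y" if "AE y in P. R y" for R
    by (rule AE_minorizing[OF P.finite_measure_axioms \<nu> _ _ that]) (use sets minor in auto)
  have "integrable R u" if "finite_measure R" "sets R = sets \<nu>" "AE y in R. a \<le> u y" "AE y in R. u y \<le> b" for R
  proof (rule finite_measure.integrable_const_bound[OF that(1), where B="\<bar>a\<bar> + \<bar>b\<bar>"])
    show "AE y in R. norm (u y) \<le> \<bar>a\<bar> + \<bar>b\<bar>"
      using that(3,4) by eventually_elim auto
    show "u \<in> borel_measurable R"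
      using u that(2) by (auto cong: measurable_cong_sets)
  qed
  note int = this[OF P.finite_measure_axioms sets(1) bnd(1,2)] this[OF Q.finite_measure_axioms sets(2) bnd(3,4)]
    this[OF \<nu> refl AE[OF bnd(1)] AE[OF bnd(2)]]
  have "(\<integral>y. b - u y \<partial>\<nu>) \<le> (\<integral>y. b - u y \<partial>P)"
    by (rule integral_minorizing_le[where b="b - a"])
       (use bnd uP sets minor P.finite_measure_axioms \<nu> in auto)
  moreover have "(\<integral>y. u y - a \<partial>\<nu>) \<le> (\<integral>y. u y - a \<partial>Q)"
    by (rule integral_minorizing_le[where b="b - a"])
       (use bnd uQ sets minor Q.finite_measure_axioms \<nu> in auto)
  ultimately show ?thesis
    using int by (simp add: P.prob_space Q.prob_space algebra_simps)
qed

text \<open>Take the \<open>m\<close>-th root of \<open>\<kappa>\<close> as rate; the constant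
  \<open>1 / \<kappa>\<close> pays for the incomplete last block of \<open>t mod m\<close>
  steps.\<close>

lemma floor_power_le_geometric:
  fixes \<kappa> :: real
  assumes "0 < \<kappa>" "\<kappa> < 1" "0 < m"
  obtains \<rho> where "0 < \<rho>" "\<rho> < 1" "\<And>t. \<kappa> ^ (t div m) \<le> \<rho> ^ t * (1 / \<kappa>)"
proof
  define \<rho> where "\<rho> = root m \<kappa>"
  show \<rho>: "0 < \<rho>" "\<rho> < 1"
    using assms by (auto simp: \<rho>_def)
  have \<kappa>: "\<kappa> = \<rho> ^ m"
    using assms by (simp add: \<rho>_def)
  fix t
  have "\<kappa> ^ (t div m) * \<kappa> = \<rho> ^ (m * (t div m)) * \<rho> ^ m"
    by (simp add: \<kappa> power_mult)
  also have "\<dots> \<le> \<rho> ^ (m * (t div m)) * \<rho> ^ (t mod m)"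
    using \<rho> assms(3) by (intro mult_left_mono power_decreasing) (auto intro: less_imp_le)
  also have "\<dots> = \<rho> ^ t"
    by (simp flip: power_add)
  finally show "\<kappa> ^ (t div m) \<le> \<rho> ^ t * (1 / \<kappa>)"
    using assms by (simp add: field_simps)
qed

text \<open>
  Doeblin's criterion. One pass through the minorized kernel \<open>P m\<close> shrinks the oscillation over \<open>S\<close>
  of \<open>x \<mapsto> P t x A\<close> by the factor \<open>1 - \<nu>(space \<nu>)\<close>, uniformly in \<open>A\<close>; the uniformity
  makes the setwise limit of \<open>P t x\<close> countably additive.
\<close>

theorem doeblin_geometrically_ergodic:
  fixes P :: "nat \<Rightarrow> 's::topological_space \<Rightarrow> 's measure"
  assumes S[measurable]: "S \<in> sets borel" and "S \<noteq> {}"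
    and kernel[measurable]: "\<And>t. P t \<in> borel \<rightarrow>\<^sub>M prob_algebra borel"
    and CK: "\<And>s t x. P (s + t) x = P s x \<bind> P t"
    and conc: "\<And>t x. x \<in> S \<Longrightarrow> AE y in P t x. y \<in> S"
    and \<nu>: "finite_measure \<nu>" "sets \<nu> = sets borel" "0 < measure \<nu> (space \<nu>)" "measure \<nu> (space \<nu>) < 1"
    and "0 < m"
    and minor: "\<And>x A. x \<in> S \<Longrightarrow> A \<in> sets borel \<Longrightarrow> measure \<nu> A \<le> measure (P m x) A"
  shows "geometrically_ergodic S P"
proof -
  define \<kappa> where "\<kappa> = 1 - measure \<nu> (space \<nu>)"
  have \<kappa>: "0 < \<kappa>" "\<kappa> < 1" using \<nu> by (auto simp: \<kappa>_def)
  define \<delta> where "\<delta> t = \<kappa> ^ (t div m)" for t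
  obtain \<rho> where \<rho>: "0 < \<rho>" "\<rho> < 1" "\<And>t. \<delta> t \<le> \<rho> ^ t * (1 / \<kappa>)"
    using floor_power_le_geometric[OF \<kappa> \<open>0 < m\<close>] unfolding \<delta>_def by blast
  have \<delta>_lim: "\<delta> \<longlonglongrightarrow> 0"
  proof (rule tendsto_sandwich[OF _ _ tendsto_const])
    show "(\<lambda>t. \<rho> ^ t * (1 / \<kappa>)) \<longlonglongrightarrow> 0"
      using \<rho> by (intro tendsto_mult_left_zero LIMSEQ_power_zero) auto
  qed (use \<rho> \<kappa> in \<open>auto simp: \<delta>_def\<close>)

  have P: "prob_space (P t x)" "sets (P t x) = sets borel" for t x
    using measurable_space[OF kernel, of x t] by (auto simp: space_prob_algebra)
  have P_space: "space (P t x) = UNIV" for t x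
    using sets_eq_imp_space_eq[OF P(2)] by simp
  have le1: "measure (P t x) A \<le> 1" for t x A
    using P(1) by (rule prob_space.prob_le_1)
  have meas[measurable]: "(\<lambda>y. measure (P t y) A) \<in> borel_measurable borel" if [measurable]: "A \<in> sets borel" for t A
    by measurable
  have meas': "(\<lambda>y. measure (P t y) A) \<in> borel_measurable (P s x)" if "A \<in> sets borel" for s t x A
    using meas[OF that, of t] P(2)[of s x] by (simp cong: measurable_cong_sets)
  have step: "measure (P (s + t) x) A = (\<integral>y. measure (P t y) A \<partial>P s x)" if "A \<in> sets borel" for s t x A
    unfolding CK
    by (rule subprob_space.measure_bind[where N=borel])
      (use P that measurable_prob_algebraD[OF kernel[of t]] in
        \<open>auto intro: prob_space_imp_subprob_space cong: measurable_cong_sets\<close>)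
  have int: "integrable (P s x) (\<lambda>y. measure (P t y) A)" if "A \<in> sets borel" for s t x A
    by (rule finite_measure.integrable_const_bound[where B=1])
      (use P(1) meas'[OF that] le1 in \<open>auto intro: prob_space.axioms\<close>)

  have osc: "measure (P t x) A - measure (P t y) A \<le> \<delta> t"
    if A[measurable]: "A \<in> sets borel" and "x \<in> S" "y \<in> S" for t x y A
    using that(2,3)
  proof (induction t arbitrary: x y rule: less_induct)
    case (less t)
    show ?case
    proof (cases "t < m")
      case True
      then show ?thesis
        using add_mono[OF le1[of t x A] measure_nonneg[of "P t y" A]] by (simp add: \<delta>_def algebra_simps)
    next
      case False
      define t' where "t' = t - m"
      with False \<open>0 < m\<close> have t: "t = m + t'" "t' < t" by auto
      define u where "u z = measure (P t' z) A" for z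
      \<comment> \<open>Extrema over \<open>S\<close> suffice because \<open>conc\<close> keeps the
        transition laws inside \<open>S\<close>. The induction hypothesis for all pairs of points
        bounds \<open>b - a\<close> by \<open>\<delta> t'\<close>.\<close>
      define a where "a = (INF z\<in>S. u z)"
      define b where "b = (SUP z\<in>S. u z)"
      have bdd: "bdd_below (u ` S)" "bdd_above (u ` S)"
        by (auto simp: u_def le1 intro!: bdd_belowI[where m=0] bdd_aboveI[where M=1])
      have ab: "a \<le> u z" "u z \<le> b" if "z \<in> S" for z
        using that bdd by (auto simp: a_def b_def intro: cINF_lower cSUP_upper)
      have "b - \<delta> t' \<le> a"
        unfolding a_def
      proof (rule cINF_greatest[OF \<open>S \<noteq> {}\<close>])
        fix z assume "z \<in> S"
        have "b \<le> u z + \<delta> t'"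
          unfolding b_def
        proof (rule cSUP_least[OF \<open>S \<noteq> {}\<close>])
          fix z' assume "z' \<in> S"
          then show "u z' \<le> u z + \<delta> t'"
            using less.IH[OF t(2) \<open>z' \<in> S\<close> \<open>z \<in> S\<close>] by (simp add: u_def)
        qed
        then show "b - \<delta> t' \<le> u z" by simp
      qed
      then have "b - a \<le> \<delta> t'" by simp
      have "measure (P t x) A - measure (P t y) A = (\<integral>z. u z \<partial>P m x) - (\<integral>z. u z \<partial>P m y)"
        by (simp add: t step u_def)
      also have "\<dots> \<le> (1 - measure \<nu> (space \<nu>)) * (b - a)"
      proof (rule integral_diff_minorizing_le)
        show "u \<in> borel_measurable \<nu>"
          using meas[OF A, of t'] \<nu>(2) unfolding u_def by (simp cong: measurable_cong_sets)
        show "AE z in P m x. a \<le> u z" "AE z in P m x. u z \<le> b"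
          by (rule eventually_mono[OF conc[OF less.prems(1)]], simp add: ab)+
        show "AE z in P m y. a \<le> u z" "AE z in P m y. u z \<le> b"
          by (rule eventually_mono[OF conc[OF less.prems(2)]], simp add: ab)+
      qed (use P \<nu> minor less.prems in auto)
      also have "\<dots> \<le> \<kappa> * \<delta> t'"
        using \<open>b - a \<le> \<delta> t'\<close> \<kappa> by (simp add: \<kappa>_def)
      also have "\<dots> = \<delta> t"
        using \<open>0 < m\<close> by (simp add: \<delta>_def t(1))
      finally show ?thesis .
    qed
  qed

  \<comment> \<open>By Chapman-Kolmogorov the value at time \<open>s + t\<close> is an average of
    \<open>measure (P t z) A\<close> over points \<open>z\<close> of \<open>S\<close>, each within
    \<open>\<delta> t\<close> of the value at \<open>y\<close>. Since \<open>s\<close> is arbitrary,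
    this gives the Cauchy property and, as \<open>s\<close> tends to infinity, the rate of
    convergence.\<close>
  have near: "\<bar>measure (P (s + t) x) A - measure (P t y) A\<bar> \<le> \<delta> t"
    if A: "A \<in> sets borel" and xy: "x \<in> S" "y \<in> S" for s t x y A
  proof -
    interpret Q: prob_space "P s x" by (rule P)
    have "AE z in P s x. measure (P t z) A \<le> measure (P t y) A + \<delta> t"
      using conc[OF xy(1), of s]
    proof eventually_elim
      case (elim z)
      then show ?case using osc[OF A _ xy(2), of z t] by simp
    qed
    then have "(\<integral>z. measure (P t z) A \<partial>P s x) \<le> measure (P t y) A + \<delta> t"
      by (intro Q.integral_le_const int A)
    moreover have "AE z in P s x. measure (P t y) A - \<delta> t \<le> measure (P t z) A"
      using conc[OF xy(1), of s]
    proof eventually_elim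
      case (elim z)
      then show ?case using osc[OF A xy(2), of z t] by simp
    qed
    then have "measure (P t y) A - \<delta> t \<le> (\<integral>z. measure (P t z) A \<partial>P s x)"
      by (intro Q.integral_ge_const int A)
    ultimately show ?thesis
      by (simp add: step[OF A] abs_le_iff)
  qed

  obtain x\<^sub>0 where x\<^sub>0: "x\<^sub>0 \<in> S" using \<open>S \<noteq> {}\<close> by auto
  define L where "L A = lim (\<lambda>t. measure (P t x\<^sub>0) A)" for A
  have L: "(\<lambda>t. measure (P t x\<^sub>0) A) \<longlonglongrightarrow> L A" if A: "A \<in> sets borel" for A
  proof -
    have "Cauchy (\<lambda>t. measure (P t x\<^sub>0) A)"
    proof (rule CauchyI')
      fix e :: real assume "0 < e"
      then obtain T where T: "\<delta> T < e"
        using order_tendstoD(2)[OF \<delta>_lim] by (auto simp: eventually_sequentially)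
      have "dist (measure (P i x\<^sub>0) A) (measure (P j x\<^sub>0) A) < e" if "T \<le> i" "i < j" for i j
      proof -
        have "\<delta> i \<le> \<delta> T"
          unfolding \<delta>_def using that(1) \<kappa> by (intro power_decreasing div_le_mono) auto
        with near[OF A x\<^sub>0 x\<^sub>0, of "j - i" i] T that show ?thesis by (auto simp: dist_real_def abs_minus_commute)
      qed
      then show "\<exists>M. \<forall>i\<ge>M. \<forall>j>i. dist (measure (P i x\<^sub>0) A) (measure (P j x\<^sub>0) A) < e" by auto
    qed
    then show ?thesis
      unfolding L_def by (simp add: Cauchy_convergent convergent_LIMSEQ_iff[symmetric])
  qed
  have rate: "\<bar>measure (P t x) A - L A\<bar> \<le> \<delta> t" if A: "A \<in> sets borel" and x: "x \<in> S" for A t x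
  proof (rule tendsto_upperbound)
    show "(\<lambda>s. \<bar>measure (P t x) A - measure (P (s + t) x\<^sub>0) A\<bar>) \<longlonglongrightarrow> \<bar>measure (P t x) A - L A\<bar>"
      by (intro tendsto_intros LIMSEQ_ignore_initial_segment L A)
    show "\<forall>\<^sub>F s in sequentially. \<bar>measure (P t x) A - measure (P (s + t) x\<^sub>0) A\<bar> \<le> \<delta> t"
      using near[OF A x\<^sub>0 x] by (simp add: abs_minus_commute)
  qed simp
  have L_nonneg: "0 \<le> L A" if "A \<in> sets borel" for A
    by (rule LIMSEQ_le_const[OF L[OF that]]) simp

  define \<S> where "\<S> = sets (restrict_space borel S)"
  have \<S>: "A \<in> \<S> \<longleftrightarrow> A \<in> sets borel \<and> A \<subseteq> S" for A
    by (simp add: \<S>_def sets_restrict_space_iff conj_commute)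
  interpret \<S>: sigma_algebra S \<S>
    using sets.sigma_algebra_axioms[of "restrict_space borel S"] by (simp add: \<S>_def space_restrict_space)
  have pos: "positive \<S> (\<lambda>A. ennreal (L A))"
    by (simp add: positive_def L_def)
  have add: "additive \<S> (\<lambda>A. ennreal (L A))"
    unfolding additive_def
  proof safe
    fix A B assume AB: "A \<in> \<S>" "B \<in> \<S>" "A \<inter> B = {}"
    have *: "measure (P t x\<^sub>0) (A \<union> B) = measure (P t x\<^sub>0) A + measure (P t x\<^sub>0) B" for t
      using AB P by (intro finite_measure.finite_measure_Union) (auto simp: \<S> intro: prob_space.axioms)
    have "(\<lambda>t. measure (P t x\<^sub>0) (A \<union> B)) \<longlonglongrightarrow> L A + L B"
      unfolding * using AB by (intro tendsto_add L) (auto simp: \<S>)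
    with L[of "A \<union> B"] AB have "L (A \<union> B) = L A + L B"
      by (auto simp: \<S> dest: LIMSEQ_unique)
    then show "ennreal (L (A \<union> B)) = ennreal (L A) + ennreal (L B)"
      using AB by (simp add: L_nonneg \<S>)
  qed
  \<comment> \<open>Continuity at the empty set is an exchange of limits: as \<open>\<delta>\<close>
    does not depend on the set, one fixed \<open>t\<close> keeps \<open>L\<close> within
    \<open>e / 2\<close> of the measure \<open>P t x\<^sub>0\<close> on all \<open>A i\<close> at
    once, and that measure is continuous.\<close>
  have cadd: "countably_additive \<S> (\<lambda>A. ennreal (L A))"
  proof (rule \<S>.empty_continuous_imp_countably_additive[OF pos add])
    fix A :: "nat \<Rightarrow> 's set"
    assume A: "range A \<subseteq> \<S>" "decseq A" "(\<Inter>i. A i) = {}"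
    then have "A i \<in> \<S>" for i by auto
    then have A_borel: "A i \<in> sets borel" for i by (simp add: \<S>)
    have "(\<lambda>i. L (A i)) \<longlonglongrightarrow> 0"
    proof (rule order_tendstoI)
      show "\<forall>\<^sub>F i in sequentially. a < L (A i)" if "a < 0" for a
        by (rule always_eventually) (use that L_nonneg[OF A_borel] in \<open>auto intro: less_le_trans\<close>)
      fix e :: real assume "0 < e"
      then obtain t where t: "\<delta> t < e / 2"
        using order_tendstoD(2)[OF \<delta>_lim, of "e / 2"] by (auto simp: eventually_sequentially)
      have "(\<lambda>i. measure (P t x\<^sub>0) (A i)) \<longlonglongrightarrow> 0"
        using finite_measure.finite_Lim_measure_decseq[OF prob_space.axioms(1)[OF P(1)[of t x\<^sub>0]], of A] A A_borel
        by (simp add: P(2) image_subset_iff)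
      then have "\<forall>\<^sub>F i in sequentially. measure (P t x\<^sub>0) (A i) < e / 2"
        using \<open>0 < e\<close> by (intro order_tendstoD(2)) auto
      then show "\<forall>\<^sub>F i in sequentially. L (A i) < e"
      proof eventually_elim
        case (elim i)
        with rate[OF A_borel x\<^sub>0, of t i] t show ?case by linarith
      qed
    qed
    then show "(\<lambda>i. ennreal (L (A i))) \<longlonglongrightarrow> 0"
      by (auto dest: tendsto_ennrealI)
  qed simp
  define \<pi> where "\<pi> = measure_of S \<S> (\<lambda>A. ennreal (L A))"
  have sets_\<pi>: "sets \<pi> = \<S>" and space_\<pi>: "space \<pi> = S"
    by (simp_all add: \<pi>_def \<S>.space_closed)
  have em_\<pi>: "emeasure \<pi> A = ennreal (L A)" if "A \<in> \<S>" for A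
    unfolding \<pi>_def using \<S>.sigma_algebra_axioms pos cadd that by (rule emeasure_measure_of_sigma)
  have m_\<pi>: "measure \<pi> A = L A" if "A \<in> \<S>" for A
    using em_\<pi>[OF that] L_nonneg that by (simp add: measure_def \<S>)
  have "measure (P t x\<^sub>0) S = 1" for t
    using prob_space.prob_eq_1[OF P(1), of S] conc[OF x\<^sub>0] P(2) by simp
  then have "L S = 1" using LIMSEQ_unique[OF L[OF S], of 1] by simp
  then have prob_\<pi>: "prob_space \<pi>"
    by (intro prob_spaceI) (simp add: space_\<pi> em_\<pi>)
  then interpret \<pi>: prob_space \<pi> .
  show ?thesis
    unfolding geometrically_ergodic_def
  \<comment> \<open>The minorization is uniform over \<open>S\<close>, so a constant serves as the
    integrable function \<open>g\<close>.\<close>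
  proof (intro exI[of _ \<pi>] exI[of _ \<rho>] exI[of _ "\<lambda>_. 1 / \<kappa>"] conjI ballI allI)
    fix x t assume "x \<in> S"
    show "(SUP A\<in>sets (restrict_space borel S). \<bar>measure (P t x) A - measure \<pi> A\<bar>) \<le> \<rho> ^ t * (1 / \<kappa>)"
    proof (rule cSUP_least)
      fix A assume "A \<in> sets (restrict_space borel S)"
      then have "A \<in> \<S>" by (simp add: \<S>_def)
      then show "\<bar>measure (P t x) A - measure \<pi> A\<bar> \<le> \<rho> ^ t * (1 / \<kappa>)"
        using rate[OF _ \<open>x \<in> S\<close>, of A t] \<rho>(3)[of t] by (auto simp: m_\<pi> \<S>)
    qed auto
  qed (use prob_\<pi> sets_\<pi> \<rho> \<kappa> in \<open>auto simp: \<S>_def\<close>)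
qed

section \<open>Projections, supports and independent pairs\<close>

lemma closest_point_subspace_eqI:
  fixes x :: "'a::euclidean_space"
  assumes U: "subspace U" and y: "y \<in> U" and orth: "\<And>u. u \<in> U \<Longrightarrow> (x - y) \<bullet> u = 0"
  shows "closest_point U x = y"
proof (rule sym, rule closest_point_unique)
  show "\<forall>z\<in>U. dist x y \<le> dist x z"
  proof
    fix z assume "z \<in> U"
    have "x - z = (x - y) + (y - z)" by simp
    then have "(norm (x - z))\<^sup>2 = (norm (x - y))\<^sup>2 + (norm (y - z))\<^sup>2"
      using norm_add_Pythagorean[of "x - y" "y - z"] orth[of "y - z"] U y \<open>z \<in> U\<close>
      by (simp add: orthogonal_def subspace_diff)
    then have "(norm (x - y))\<^sup>2 \<le> (norm (x - z))\<^sup>2" by simp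
    then show "dist x y \<le> dist x z"
      by (simp add: dist_norm power2_le_iff_abs_le)
  qed
qed (use U y in \<open>auto simp: subspace_imp_convex closed_subspace\<close>)

text \<open>The variational inequality of the closest point, tested at the point displaced by
  \<open>u\<close> and by \<open>- u\<close>, gives both signs of the inner product.\<close>

lemma closest_point_subspace_orthogonal:
  fixes x :: "'a::euclidean_space"
  assumes U: "subspace U" and u: "u \<in> U"
  shows "(x - closest_point U x) \<bullet> u = 0"
proof -
  let ?p = "closest_point U x"
  have p: "?p \<in> U"
    using U u by (intro closest_point_in_set closed_subspace) auto
  have "(x - ?p) \<bullet> v \<le> 0" if "v \<in> U" for v
    using closest_point_dot[of U "?p + v" x] U p that
    by (simp add: subspace_add subspace_imp_convex closed_subspace)
  from this[of u] this[of "- u"] u U show ?thesis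
    by (simp add: subspace_neg)
qed

lemma linear_closest_point_subspace:
  fixes U :: "'a::euclidean_space set"
  assumes U: "subspace U"
  shows "linear (closest_point U)"
proof -
  have p: "closest_point U x \<in> U" for x
    using U subspace_0[OF U] by (intro closest_point_in_set closed_subspace) auto
  note orth = closest_point_subspace_orthogonal[OF U]
  show ?thesis
  proof (rule linearI)
    show "closest_point U (x + y) = closest_point U x + closest_point U y" for x y
      using orth[of _ x] orth[of _ y] p U
      by (intro closest_point_subspace_eqI) (auto simp: subspace_add algebra_simps)
    show "closest_point U (c *\<^sub>R x) = c *\<^sub>R closest_point U x" for c x
      using orth[of _ x] p U
      by (intro closest_point_subspace_eqI) (auto simp: subspace_scale simp flip: scaleR_diff_right)
  qed
qed

lemma linear_disagreement: "linear disagreement"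
  using linear_closest_point_subspace[OF subspace_orthogonal_comp] by (simp add: disagreement_def[abs_def])

lemma disagreement_in: "disagreement x \<in> consensus\<^sup>\<bottom>"
  unfolding disagreement_def
  using subspace_0[OF subspace_orthogonal_comp] closed_subspace[OF subspace_orthogonal_comp]
  by (intro closest_point_in_set) auto

lemma disagreement_ident: "x \<in> consensus\<^sup>\<bottom> \<Longrightarrow> disagreement x = x"
  by (simp add: disagreement_def closest_point_self)

lemma disagreement_consensus: "z \<in> consensus \<Longrightarrow> disagreement z = 0"
  unfolding disagreement_def
  by (rule closest_point_subspace_eqI[OF subspace_orthogonal_comp])
    (auto simp: subspace_0[OF subspace_orthogonal_comp] orthogonal_comp_def orthogonal_def)

lemma norm_disagreement_le: "norm (disagreement x) \<le> norm x"
proof -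
  have "dist (disagreement x) (disagreement 0) \<le> dist x 0"
    unfolding disagreement_def using subspace_orthogonal_comp subspace_0[OF subspace_orthogonal_comp]
    by (intro closest_point_lipschitz) (auto intro: subspace_imp_convex closed_subspace)
  then show ?thesis by (simp add: linear_0[OF linear_disagreement])
qed

lemma continuous_disagreement: "continuous_on A disagreement"
  using linear_disagreement unfolding linear_conv_bounded_linear by (rule linear_continuous_on)

lemma measurable_disagreement[measurable]: "disagreement \<in> borel_measurable borel"
  by (intro borel_measurable_continuous_onI continuous_disagreement)

text \<open>Subtracting the consensus vector that repeats \<open>u\<close> does not change the
  projection, and what remains has all coordinates at most \<open>s\<close>. The cardinality is the
  price of the crude bound by the sum of the coordinates.\<close>

lemma norm_disagreement_le_agents:
  fixes x :: "('n::finite, 'd::finite) state"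
  assumes "\<And>i. dist (agent x i) u \<le> s"
  shows "norm (disagreement x) \<le> real CARD('n \<times> 'd) * s"
proof -
  define z :: "('n, 'd) state" where "z = (\<chi> p. u $ snd p)"
  have "z \<in> consensus"
    unfolding consensus_def by (auto simp: z_def agent_def intro!: exI[of _ u])
  then have "disagreement x = disagreement (x - z)"
    by (simp add: linear_diff[OF linear_disagreement] disagreement_consensus)
  also have "norm \<dots> \<le> norm (x - z)" by (rule norm_disagreement_le)
  also have "\<dots> \<le> (\<Sum>p\<in>UNIV. \<bar>(x - z) $ p\<bar>)" by (rule norm_le_l1_cart)
  also have "\<dots> \<le> (\<Sum>p\<in>(UNIV :: ('n \<times> 'd) set). s)"
  proof (rule sum_mono)
    fix p :: "'n \<times> 'd"
    show "\<bar>(x - z) $ p\<bar> \<le> s"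
      using component_le_norm_cart[of "agent x (fst p) - u" "snd p"] assms[of "fst p"]
      by (simp add: z_def agent_def dist_norm)
  qed
  finally show ?thesis by simp
qed

section \<open>Topological supports of measures\<close>

lemma closed_msupp: "closed (msupp \<mu>)"
proof -
  have "- msupp \<mu> = \<Union>{U. open U \<and> emeasure \<mu> U = 0}"
    by (auto simp: msupp_def)
  then show ?thesis
    by (simp add: closed_def open_Union)
qed

text \<open>The complement of the support is a union of open null sets; second countability reduces
  it to the countably many null sets of a basis.\<close>

lemma AE_msupp:
  fixes \<mu> :: "'a::second_countable_topology measure"
  assumes [measurable_cong]: "sets \<mu> = sets borel"
  shows "AE x in \<mu>. x \<in> msupp \<mu>"
proof -
  obtain B :: "'a set set" where B: "countable B" "topological_basis B"
    using ex_countable_basis by blast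
  have "AE x in \<mu>. x \<notin> \<Union>{U\<in>B. emeasure \<mu> U = 0}"
  proof (rule AE_not_in)
    have "(\<Union>U\<in>{U \<in> B. emeasure \<mu> U = 0}. U) \<in> null_sets \<mu>"
      using B topological_basis_open[OF B(2)] assms by (intro null_sets_UN') (auto simp: null_sets_def)
    then show "\<Union>{U\<in>B. emeasure \<mu> U = 0} \<in> null_sets \<mu>" by simp
  qed
  then show ?thesis
  proof eventually_elim
    case (elim x)
    show ?case
      unfolding msupp_def
    proof safe
      fix U assume "open U" "x \<in> U"
      then obtain U' where U': "U' \<in> B" "x \<in> U'" "U' \<subseteq> U"
        using topological_basisE[OF B(2)] by metis
      then have "0 < emeasure \<mu> U'" using elim by (auto simp: zero_less_iff_neq_zero)
      also have "\<dots> \<le> emeasure \<mu> U"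
        using U' \<open>open U\<close> assms by (intro emeasure_mono) auto
      finally show "0 < emeasure \<mu> U" .
    qed
  qed
qed

lemma msupp_subset_closed:
  assumes "sets \<mu> = sets borel" "closed C" "AE x in \<mu>. x \<in> C"
  shows "msupp \<mu> \<subseteq> C"
proof
  fix x assume x: "x \<in> msupp \<mu>"
  have "emeasure \<mu> (- C) = 0"
    using assms sets_eq_imp_space_eq[OF assms(1)] by (subst AE_iff_measurable[symmetric, where P="\<lambda>x. x \<in> C"]) auto
  then show "x \<in> C"
    using x assms(2) by (auto simp: msupp_def dest!: spec[of _ "- C"])
qed

lemma (in prob_space) msupp_nonempty:
  fixes X :: "'a \<Rightarrow> 'b::second_countable_topology"
  assumes [measurable]: "X \<in> borel_measurable M"
  shows "msupp (distr M borel X) \<noteq> {}"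
proof
  assume "msupp (distr M borel X) = {}"
  with AE_msupp[of "distr M borel X"] have "AE x in distr M borel X. False" by simp
  then have "AE x in M. False" by (subst (asm) AE_distr_iff) auto
  then show False by simp
qed

text \<open>Independence makes the joint law a product, and the product measure is computed by
  integrating its sections. This is the source of the Markov property: \<open>X\<close> will be the
  present state and \<open>Y\<close> the next noise.\<close>

lemma (in prob_space) distr_indep_var_eq_bind:
  assumes ind: "indep_var S X T Y" and g[measurable]: "(\<lambda>(x, y). g x y) \<in> S \<Otimes>\<^sub>M T \<rightarrow>\<^sub>M R"
  shows "distr M R (\<lambda>\<omega>. g (X \<omega>) (Y \<omega>)) = distr M S X \<bind> (\<lambda>x. distr (distr M T Y) R (g x))"
proof -
  have X[measurable]: "X \<in> M \<rightarrow>\<^sub>M S" and Y[measurable]: "Y \<in> M \<rightarrow>\<^sub>M T"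
    using ind by (auto simp: indep_var_distribution_eq)
  interpret X: prob_space "distr M S X" by (rule prob_space_distr) simp
  interpret Y: prob_space "distr M T Y" by (rule prob_space_distr) simp
  have nonempty: "space (distr M S X) \<noteq> {}" by (rule X.not_empty)
  have K: "(\<lambda>x. distr (distr M T Y) R (g x)) \<in> distr M S X \<rightarrow>\<^sub>M subprob_algebra R"
    by (rule measurable_distr2[where M=T])
      (auto simp: space_subprob_algebra intro!: measurable_const prob_space_imp_subprob_space Y.prob_space_axioms)
  have "distr M R (\<lambda>\<omega>. g (X \<omega>) (Y \<omega>)) = distr (distr M (S \<Otimes>\<^sub>M T) (\<lambda>\<omega>. (X \<omega>, Y \<omega>))) R (\<lambda>(x, y). g x y)"
    by (simp add: distr_distr comp_def)
  also have "\<dots> = distr (distr M S X \<Otimes>\<^sub>M distr M T Y) R (\<lambda>(x, y). g x y)"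
    using ind by (simp add: indep_var_distribution_eq)
  also have "\<dots> = distr M S X \<bind> (\<lambda>x. distr (distr M T Y) R (g x))"
  proof (rule measure_eqI)
    fix A assume "A \<in> sets (distr (distr M S X \<Otimes>\<^sub>M distr M T Y) R (\<lambda>(x, y). g x y))"
    then have A[measurable]: "A \<in> sets R" by simp
    have "emeasure (distr (distr M S X \<Otimes>\<^sub>M distr M T Y) R (\<lambda>(x, y). g x y)) A =
      emeasure (distr M S X \<Otimes>\<^sub>M distr M T Y) ((\<lambda>(x, y). g x y) -` A \<inter> space (S \<Otimes>\<^sub>M T))"
      by (subst emeasure_distr) (auto simp: space_pair_measure)
    also have "\<dots> = (\<integral>\<^sup>+ x. emeasure (distr M T Y) (Pair x -` ((\<lambda>(x, y). g x y) -` A \<inter> space (S \<Otimes>\<^sub>M T))) \<partial>distr M S X)"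
    proof (rule Y.emeasure_pair_measure_alt)
      have "sets (distr M S X \<Otimes>\<^sub>M distr M T Y) = sets (S \<Otimes>\<^sub>M T)"
        by (intro sets_pair_measure_cong) simp_all
      then show "(\<lambda>(x, y). g x y) -` A \<inter> space (S \<Otimes>\<^sub>M T) \<in> sets (distr M S X \<Otimes>\<^sub>M distr M T Y)"
        using measurable_sets[OF g A] by simp
    qed
    also have "\<dots> = (\<integral>\<^sup>+ x. emeasure (distr (distr M T Y) R (g x)) A \<partial>distr M S X)"
    proof (rule nn_integral_cong)
      fix x assume x: "x \<in> space (distr M S X)"
      then have [measurable]: "g x \<in> T \<rightarrow>\<^sub>M R" using g by simp
      show "emeasure (distr M T Y) (Pair x -` ((\<lambda>(x, y). g x y) -` A \<inter> space (S \<Otimes>\<^sub>M T))) =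
        emeasure (distr (distr M T Y) R (g x)) A"
        using x by (subst emeasure_distr[of "g x"]) (auto simp: space_pair_measure intro!: arg_cong[where f="emeasure _"])
    qed
    also have "\<dots> = emeasure (distr M S X \<bind> (\<lambda>x. distr (distr M T Y) R (g x))) A"
      by (rule emeasure_bind[OF nonempty K A, symmetric])
    finally show "emeasure (distr (distr M S X \<Otimes>\<^sub>M distr M T Y) R (\<lambda>(x, y). g x y)) A =
      emeasure (distr M S X \<bind> (\<lambda>x. distr (distr M T Y) R (g x))) A" .
  qed (use sets_bind[OF sets_kernel[OF K] nonempty] in auto)
  finally show ?thesis .
qed

section \<open>The Laplacian on the complement of the consensus space\<close>

text \<open>Eigenvectors for distinct eigenvalues are orthogonal, hence independent. Finiteness is
  what gives \<open>Max\<close> and \<open>Min\<close> in \<open>lambda_max\<close> and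
  \<open>lambda_2\<close> their meaning.\<close>

lemma finite_eigenvalues_symmetric:
  fixes A :: "real ^ 'm ^ 'm"
  assumes "transpose A = A"
  shows "finite (eigenvalues A)"
proof -
  have "\<forall>l\<in>eigenvalues A. \<exists>v. v \<noteq> 0 \<and> A *v v = l *\<^sub>R v"
    by (simp add: eigenvalues_def)
  then obtain v where v: "\<And>l. l \<in> eigenvalues A \<Longrightarrow> v l \<noteq> 0 \<and> A *v v l = l *\<^sub>R v l"
    by (auto dest!: bchoice)
  have orth: "v l \<bullet> v l' = 0" if "l \<in> eigenvalues A" "l' \<in> eigenvalues A" "l \<noteq> l'" for l l'
  proof -
    have "l * (v l \<bullet> v l') = (A *v v l) \<bullet> v l'"
      using v[OF that(1)] by simp
    also have "\<dots> = v l \<bullet> (A *v v l')"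
      by (metis assms dot_lmul_matrix transpose_matrix_vector)
    also have "\<dots> = l' * (v l \<bullet> v l')"
      using v[OF that(2)] by simp
    finally show ?thesis using that(3) by simp
  qed
  have "inj_on v (eigenvalues A)"
    by (rule inj_onI) (metis v orth inner_eq_zero_iff)
  moreover have "finite (v ` eigenvalues A)"
  proof (rule independent_imp_finite, rule pairwise_orthogonal_independent)
    show "pairwise orthogonal (v ` eigenvalues A)"
      using orth by (force simp: pairwise_def orthogonal_def)
  qed (use v in auto)
  ultimately show ?thesis by (rule finite_imageD[rotated])
qed

text \<open>
  A maximizer \<open>v\<close> of \<open>norm (f v)\<close> on the unit sphere satisfies \<open>f (f v) = m\<^sup>2 v\<close> with
  \<open>m = norm (f v)\<close>, so either \<open>v\<close> or \<open>f v + m v\<close> is an eigenvector for \<open>- m\<close> or \<open>m\<close>.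
\<close>

lemma selfadjoint_norm_eigenvector:
  fixes f :: "'a::euclidean_space \<Rightarrow> 'a"
  assumes f: "linear f" and U: "subspace U" and inv: "\<And>x. x \<in> U \<Longrightarrow> f x \<in> U"
    and adj: "\<And>x y. x \<in> U \<Longrightarrow> y \<in> U \<Longrightarrow> f x \<bullet> y = x \<bullet> f y"
    and y: "y \<in> U" "y \<noteq> 0"
  obtains \<mu> v where "v \<in> U" "v \<noteq> 0" "f v = \<mu> *\<^sub>R v" "\<And>u. u \<in> U \<Longrightarrow> norm (f u) \<le> \<bar>\<mu>\<bar> * norm u"
proof -
  interpret linear f by fact
  have "compact (U \<inter> sphere 0 1)"
    by (intro closed_Int_compact closed_subspace U compact_sphere)
  moreover have "y /\<^sub>R norm y \<in> U \<inter> sphere 0 1"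
    using y U by (simp add: subspace_scale)
  moreover have "continuous_on (U \<inter> sphere 0 1) (\<lambda>x. norm (f x))"
    using f by (intro continuous_intros linear_continuous_on) (simp add: linear_conv_bounded_linear)
  ultimately obtain v where v: "v \<in> U" "norm v = 1"
    and max: "\<And>u. u \<in> U \<Longrightarrow> norm u = 1 \<Longrightarrow> norm (f u) \<le> norm (f v)"
    using continuous_attains_sup[of "U \<inter> sphere 0 1" "\<lambda>x. norm (f x)"] by fastforce
  define m where "m = norm (f v)"
  have bound: "norm (f u) \<le> m * norm u" if "u \<in> U" for u
  proof (cases "u = 0")
    case True
    then show ?thesis by (simp add: zero)
  next
    case False
    then have "norm (f (u /\<^sub>R norm u)) \<le> m"
      unfolding m_def using that U by (intro max) (auto simp: subspace_scale)
    then show ?thesis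
      using False by (simp add: scale divide_simps mult.commute)
  qed
  define g where "g u = m\<^sup>2 *\<^sub>R u - f (f u)" for u
  have g_nonneg: "0 \<le> g u \<bullet> u" if "u \<in> U" for u
  proof -
    have "g u \<bullet> u = (m * norm u)\<^sup>2 - (norm (f u))\<^sup>2"
      using adj[of "f u" u] inv that
      by (simp add: g_def inner_diff_left power_mult_distrib power2_norm_eq_inner)
    then show ?thesis
      using power_mono[OF bound[OF that], of 2] by simp
  qed
  define w where "w = g v"
  have w: "w \<in> U"
    using v U inv by (simp add: w_def g_def subspace_diff subspace_scale)
  have gv: "g v \<bullet> v = 0"
    using adj[of "f v" v] inv v
    by (simp add: g_def inner_diff_left m_def power2_norm_eq_inner flip: power2_norm_eq_inner[of v])
  have gw: "g w \<bullet> v = w \<bullet> w"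
    using adj[of "f w" v] adj[of w "f v"] inv v w
    by (simp add: w_def g_def inner_diff_left inner_diff_right)
  \<comment> \<open>The form is tested at \<open>v - s *\<^sub>R w\<close>: its constant term
    vanishes, and for small positive \<open>s\<close> the linear term
    \<open>- 2 * s * (w \<bullet> w)\<close> would make it negative unless
    \<open>w = 0\<close>.\<close>
  have quad: "0 \<le> (g w \<bullet> w) * s\<^sup>2 - 2 * s * (w \<bullet> w)" for s
  proof -
    have "g (v - s *\<^sub>R w) = w - s *\<^sub>R g w"
      unfolding g_def w_def diff scale by (simp add: algebra_simps)
    moreover have "(w - s *\<^sub>R g w) \<bullet> (v - s *\<^sub>R w) = (g w \<bullet> w) * s\<^sup>2 - 2 * s * (w \<bullet> w)"
      using gv gw
      by (simp add: w_def[symmetric] inner_diff_left inner_diff_right power2_eq_square algebra_simps)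
    ultimately have "g (v - s *\<^sub>R w) \<bullet> (v - s *\<^sub>R w) = (g w \<bullet> w) * s\<^sup>2 - 2 * s * (w \<bullet> w)"
      by simp
    then show ?thesis
      using g_nonneg[of "v - s *\<^sub>R w"] v w U by (simp add: subspace_diff subspace_scale)
  qed
  have "w \<bullet> w \<le> 0"
  proof (rule ccontr)
    assume "\<not> w \<bullet> w \<le> 0"
    define c where "c = g w \<bullet> w"
    have "0 \<le> c" using g_nonneg[OF w] by (simp add: c_def)
    \<comment> \<open>Small enough for the linear term to win; the \<open>+ 1\<close> avoids a
      division by zero when \<open>c = 0\<close>.\<close>
    define s where "s = (w \<bullet> w) / (c + 1)"
    have "0 < s"
      using \<open>\<not> w \<bullet> w \<le> 0\<close> \<open>0 \<le> c\<close> unfolding s_def by (intro divide_pos_pos) auto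
    have "0 \<le> s * (c * s - 2 * (w \<bullet> w))"
      using quad[of s] by (simp add: c_def power2_eq_square algebra_simps)
    then have "2 * (w \<bullet> w) \<le> c * s"
      using \<open>0 < s\<close> by (simp add: zero_le_mult_iff)
    also have "\<dots> \<le> (c + 1) * s"
      using \<open>0 < s\<close> by (simp add: algebra_simps)
    also have "\<dots> = w \<bullet> w"
      using \<open>0 \<le> c\<close> by (simp add: s_def)
    finally show False using \<open>\<not> w \<bullet> w \<le> 0\<close> by simp
  qed
  then have "w = 0" by (metis inner_ge_zero inner_eq_zero_iff order_antisym)
  then have ff: "f (f v) = m\<^sup>2 *\<^sub>R v"
    by (simp add: w_def g_def)
  have "0 \<le> m" by (simp add: m_def)
  show thesis
  proof (cases "f v = (- m) *\<^sub>R v")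
    case True
    show thesis
      by (rule that[of v "- m"]) (use True v bound \<open>0 \<le> m\<close> in auto)
  next
    case False
    define u where "u = f v + m *\<^sub>R v"
    have "f u = m *\<^sub>R u"
      by (simp add: u_def add scale ff power2_eq_square algebra_simps)
    moreover have "u \<noteq> 0"
      using False by (simp add: u_def eq_neg_iff_add_eq_0)
    moreover have "u \<in> U"
      using v U inv by (simp add: u_def subspace_add subspace_scale)
    ultimately show thesis
      using that[of u m] bound \<open>0 \<le> m\<close> by simp
  qed
qed

section \<open>Kernel and spectrum of the state-dependent Laplacian\<close>

locale coupling =
  fixes h S\<^sub>0 :: real and k :: "'n::finite \<Rightarrow> 'n \<Rightarrow> real" and \<phi> :: "real \<Rightarrow> real"
  assumes h_pos: "h > 0"
    and k_nonneg: "\<And>i j. k i j \<ge> 0"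
    and phi_pos: "\<And>r. r \<ge> 0 \<Longrightarrow> \<phi> r > 0"
    and phi_continuous: "continuous_on {0..} \<phi>"
    and phi_bounded: "\<And>r. r \<ge> 0 \<Longrightarrow> \<phi> r \<le> S\<^sub>0"
    and undirected: "\<And>i j. k i j = k j i"
    and simple: "irrefl (interaction_graph k)"
    and connected: "\<And>i j. (i, j) \<in> (interaction_graph k)\<^sup>*"
begin

lemma k_diag: "k i i = 0"
  using simple k_nonneg[of i i] by (auto simp: irrefl_def interaction_graph_def not_less intro: order_antisym)

lemma laplacian_mult_nth:
  fixes x y :: "('n, 'd::finite) state"
  shows "(laplacian k \<phi> x *v y) $ (i, a)
    = (\<Sum>j\<in>UNIV. k i j * \<phi> (norm (agent x j - agent x i)) * (y $ (i, a) - y $ (j, a)))"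
proof -
  define c where "c j = k i j * \<phi> (norm (agent x j - agent x i))" for j
  have "(laplacian k \<phi> x *v y) $ (i, a) = (\<Sum>(j, b)\<in>UNIV \<times> UNIV.
      (if i = j then sum c UNIV else - c j) * (if a = b then 1 else 0) * y $ (j, b))"
    unfolding matrix_vector_mult_def laplacian_def UNIV_Times_UNIV
    by (auto simp: c_def mat_def Let_def split_beta intro!: sum.cong)
  also have "\<dots> = (\<Sum>j\<in>UNIV. (if i = j then sum c UNIV else - c j) * y $ (j, a))"
    by (subst sum.cartesian_product[symmetric]) (simp add: if_distrib[of "\<lambda>u. _ * u * _"] cong: if_cong)
  \<comment> \<open>Subtracting \<open>c j\<close> also at \<open>j = i\<close> is harmless, since a
    simple graph has no loops and so \<open>c i = 0\<close>.\<close>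
  also have "\<dots> = (\<Sum>j\<in>UNIV. (if i = j then sum c UNIV * y $ (i, a) else 0) - c j * y $ (j, a))"
    by (intro sum.cong) (auto simp: c_def k_diag)
  also have "\<dots> = (\<Sum>j\<in>UNIV. c j * (y $ (i, a) - y $ (j, a)))"
    by (simp add: sum_subtractf sum_distrib_right right_diff_distrib)
  finally show ?thesis by (simp add: c_def)
qed

lemma transpose_laplacian: "transpose (laplacian k \<phi> (x :: ('n, 'd::finite) state)) = laplacian k \<phi> x"
proof -
  have "laplacian k \<phi> x $ q $ p = laplacian k \<phi> x $ p $ q" for p q
    using undirected[of "fst p" "fst q"] norm_minus_commute[of "agent x (fst p)" "agent x (fst q)"]
    by (cases "fst p = fst q"; cases "snd p = snd q") (simp_all add: laplacian_def Let_def mat_def)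
  then show ?thesis by (simp add: transpose_def vec_eq_iff)
qed

lemma consensus_iff: "x \<in> consensus \<longleftrightarrow> (\<forall>i j a. x $ (i, a) = x $ (j, a))"
proof -
  have "x \<in> consensus \<longleftrightarrow> (\<forall>i j. agent x i = agent x j)"
    by (auto simp: consensus_def)
  then show ?thesis by (auto simp: agent_def vec_eq_iff)
qed

lemma laplacian_consensus: "z \<in> consensus \<Longrightarrow> laplacian k \<phi> x *v z = 0"
proof -
  assume "z \<in> consensus"
  then have "z $ (i, a) = z $ (j, a)" for i j a by (simp add: consensus_iff)
  then have "(laplacian k \<phi> x *v z) $ (i, a) = 0" for i a
    unfolding laplacian_mult_nth by (intro sum.neutral) (metis diff_self mult_zero_right)
  then show ?thesis by (auto simp: vec_eq_iff)
qed

text \<open>The maximum principle: the agents at which a coordinate is maximal are closed under edges.\<close>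

lemma laplacian_kernel:
  fixes x y :: "('n, 'd::finite) state"
  assumes "laplacian k \<phi> x *v y = 0"
  shows "y \<in> consensus"
proof -
  have "\<exists>c. \<forall>j. y $ (j, a) = c" for a
  proof -
    obtain i where i: "\<And>j. y $ (j, a) \<le> y $ (i, a)"
      using ex_is_arg_min_if_finite[of UNIV "\<lambda>j. - y $ (j, a)"]
      by (auto simp: is_arg_min_linorder)
    have "y $ (j, a) = y $ (i, a)" if "(i, j) \<in> (interaction_graph k)\<^sup>*" for j
      using that
    proof (induction rule: rtrancl_induct)
      case (step j l)
      \<comment> \<open>At a maximizing agent all terms of this vanishing sum are nonnegative, so
        each is 0; the positive weight of an edge then passes the maximal value on to the
        neighbour.\<close>
      have "(\<Sum>l\<in>UNIV. k j l * \<phi> (norm (agent x l - agent x j)) * (y $ (j, a) - y $ (l, a))) = 0"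
        using assms by (simp flip: laplacian_mult_nth)
      moreover have "0 \<le> k j l * \<phi> (norm (agent x l - agent x j)) * (y $ (j, a) - y $ (l, a))" for l
        using i[of l] step.IH by (intro mult_nonneg_nonneg k_nonneg less_imp_le[OF phi_pos]) auto
      ultimately have "k j l * \<phi> (norm (agent x l - agent x j)) * (y $ (j, a) - y $ (l, a)) = 0"
        by (subst (asm) sum_nonneg_eq_0_iff) auto
      moreover have "k j l \<noteq> 0" "\<phi> (norm (agent x l - agent x j)) \<noteq> 0"
        using step.hyps(2) phi_pos[of "norm (agent x l - agent x j)"] by (auto simp: interaction_graph_def)
      ultimately show ?case using step.IH by simp
    qed simp
    then show ?thesis using connected by blast
  qed
  then show ?thesis by (metis consensus_iff)
qed

text \<open>The Laplacian is symmetric and annihilates consensus vectors.\<close>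

lemma laplacian_orthogonal:
  fixes x y :: "('n, 'd::finite) state"
  assumes "y \<in> consensus\<^sup>\<bottom>"
  shows "laplacian k \<phi> x *v y \<in> consensus\<^sup>\<bottom>"
  unfolding orthogonal_comp_def orthogonal_def
proof safe
  fix z :: "('n, 'd) state" assume "z \<in> consensus"
  have "z \<bullet> (laplacian k \<phi> x *v y) = (laplacian k \<phi> x *v z) \<bullet> y"
    by (metis transpose_laplacian dot_lmul_matrix transpose_matrix_vector)
  then show "z \<bullet> (laplacian k \<phi> x *v y) = 0"
    using laplacian_consensus[OF \<open>z \<in> consensus\<close>] by simp
qed

text \<open>\<open>selfadjoint_norm_eigenvector\<close> applies to \<open>I - hL\<close> on the
  complement, and its eigenvalue is \<open>1 - h * l\<close> for an eigenvalue \<open>l\<close> of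
  the Laplacian. If \<open>l\<close> were 0, the eigenvector would be a consensus vector orthogonal
  to itself. The vector \<open>y\<close> witnesses that the complement is nontrivial; the Laplacian
  may be taken at any other state \<open>x\<close>.\<close>

lemma contraction_eigenvalue:
  fixes x y :: "('n, 'd::finite) state"
  assumes y: "y \<in> consensus\<^sup>\<bottom>" "y \<noteq> 0"
  obtains l where "l \<in> eigenvalues (laplacian k \<phi> x) - {0}"
    "\<And>u. u \<in> consensus\<^sup>\<bottom> \<Longrightarrow> norm ((mat 1 - h *\<^sub>R laplacian k \<phi> x) *v u) \<le> \<bar>1 - h * l\<bar> * norm u"
proof -
  let ?L = "laplacian k \<phi> x" and ?U = "consensus\<^sup>\<bottom> :: ('n, 'd) state set"
  let ?f = "\<lambda>u. (mat 1 - h *\<^sub>R ?L) *v u"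
  have f: "?f u = u - h *\<^sub>R (?L *v u)" for u
    by (simp add: matrix_vector_mult_diff_rdistrib scaleR_matrix_vector_assoc)
  have adj: "(?L *v u) \<bullet> u' = u \<bullet> (?L *v u')" for u u'
    by (metis transpose_laplacian dot_lmul_matrix transpose_matrix_vector)
  obtain \<mu> v where v: "v \<in> ?U" "v \<noteq> 0" "?f v = \<mu> *\<^sub>R v"
    and bound: "\<And>u. u \<in> ?U \<Longrightarrow> norm (?f u) \<le> \<bar>\<mu>\<bar> * norm u"
  proof (rule selfadjoint_norm_eigenvector[of ?f ?U y])
    show "?f u \<bullet> u' = u \<bullet> ?f u'" for u u'
      by (simp add: f inner_diff_left inner_diff_right adj)
    show "?f u \<in> ?U" if "u \<in> ?U" for u
      unfolding f using that
      by (intro subspace_diff subspace_scale subspace_orthogonal_comp laplacian_orthogonal)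
  qed (use y in \<open>auto simp: subspace_orthogonal_comp matrix_vector_mul_linear\<close>)
  define l where "l = (1 - \<mu>) / h"
  have \<mu>: "\<mu> = 1 - h * l" using h_pos by (simp add: l_def)
  have "h *\<^sub>R (?L *v v) = h *\<^sub>R (l *\<^sub>R v)"
    using v(3) unfolding f \<mu> by (simp add: algebra_simps)
  then have Lv: "?L *v v = l *\<^sub>R v"
    by (rule scaleR_left_imp_eq[rotated]) (use h_pos in simp)
  moreover have "l \<noteq> 0"
  proof
    assume "l = 0"
    with Lv have "v \<in> consensus" by (intro laplacian_kernel) simp
    with v show False by (auto simp: orthogonal_comp_def orthogonal_def)
  qed
  ultimately show thesis
    using v bound by (intro that[of l]) (auto simp: eigenvalues_def \<mu>)
qed

lemma finite_eigenvalues_laplacian: "finite (eigenvalues (laplacian k \<phi> x))"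
  by (rule finite_eigenvalues_symmetric[OF transpose_laplacian])

end

section \<open>The state space\<close>

locale noisy_coupling = coupling h S\<^sub>0 k \<phi> + prob_space M
  for M :: "'a measure" and h S\<^sub>0 :: real and k :: "'n::finite \<Rightarrow> 'n \<Rightarrow> real" and \<phi> :: "real \<Rightarrow> real" +
  fixes R\<^sub>0 W :: real
    and x0 :: "'a \<Rightarrow> ('n, 'd::finite) state"
    and w :: "nat \<Rightarrow> 'a \<Rightarrow> ('n, 'd) state"
  assumes x0_rv[measurable]: "x0 \<in> borel_measurable M"
    and x0_bounded: "AE \<omega> in M. norm (x0 \<omega>) \<le> R\<^sub>0"
    and w_iid: "iid M w"
    and w_entries_iid: "\<And>t. iid M (\<lambda>i \<omega>. agent (w t \<omega>) i)"
    and w_bounded: "\<And>t. AE \<omega> in M. norm (w t \<omega>) \<le> W"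
    and w_density: "\<And>t. \<exists>f. (\<forall>z. 0 \<le> f z) \<and> lower_semicontinuous f \<and>
               distributed M lborel (w t) (\<lambda>z. ennreal (f z))"
    and zeta_less_1: "(SUP (x, t) \<in> trajectories M h k \<phi> x0 w \<times> UNIV.
            max \<bar>1 - h * lambda_2 (laplacian k \<phi> (x t))\<bar>
                \<bar>1 - h * lambda_max (laplacian k \<phi> (x t))\<bar>) < 1"
begin

definition drift :: "('n, 'd) state \<Rightarrow> ('n, 'd) state" where
  "drift y = (mat 1 - h *\<^sub>R laplacian k \<phi> y) *v y"

definition noise_law :: "('n, 'd) state measure" where
  "noise_law = distr M borel (\<lambda>\<omega>. disagreement (w 0 \<omega>))"

definition initial_law :: "('n, 'd) state measure" where
  "initial_law = distr M borel (\<lambda>\<omega>. disagreement (x0 \<omega>))"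

definition step_kernel :: "('n, 'd) state \<Rightarrow> ('n, 'd) state measure" where
  "step_kernel y = distr noise_law borel (\<lambda>v. drift y + h *\<^sub>R v)"

abbreviation "states \<equiv> state_space M h k \<phi> x0 w"
abbreviation "P \<equiv> transition M h k \<phi> w"

lemma network_Suc: "network h k \<phi> x v (Suc t) = drift (network h k \<phi> x v t) + h *\<^sub>R v t"
  by (simp add: drift_def)

lemma network_cong: "(\<And>s. s < t \<Longrightarrow> v s = v' s) \<Longrightarrow> network h k \<phi> x v t = network h k \<phi> x v' t"
  by (induction t) auto

lemma w_indep: "indep_vars (\<lambda>_. borel) w UNIV"
  using w_iid by (simp add: iid_def)

lemma w_rv[measurable]: "w t \<in> borel_measurable M"
  using w_indep by (simp add: indep_vars_def)

lemma distr_w: "distr M borel (w t) = distr M borel (w 0)"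
  using w_iid by (simp add: iid_def)

lemma distr_disagreement_w: "distr M borel (\<lambda>\<omega>. disagreement (w t \<omega>)) = noise_law"
proof -
  have *: "distr M borel (\<lambda>\<omega>. disagreement (w t \<omega>)) = distr (distr M borel (w t)) borel disagreement" for t
    by (simp add: distr_distr comp_def)
  show ?thesis
    unfolding noise_law_def *[of t] *[of 0] distr_w[of t] ..
qed

lemma prob_space_noise_law: "prob_space noise_law"
  unfolding noise_law_def by (rule prob_space_distr) simp

lemma sets_noise_law[simp, measurable_cong]: "sets noise_law = sets borel"
  by (simp add: noise_law_def)

lemma drift_eq: "drift y = y - h *\<^sub>R (laplacian k \<phi> y *v y)"
  by (simp add: drift_def matrix_vector_mult_diff_rdistrib scaleR_matrix_vector_assoc)

lemma drift_orthogonal: "y \<in> consensus\<^sup>\<bottom> \<Longrightarrow> drift y \<in> consensus\<^sup>\<bottom>"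
  unfolding drift_eq by (intro subspace_diff subspace_scale subspace_orthogonal_comp laplacian_orthogonal)

lemma continuous_drift: "continuous_on A drift"
proof -
  have phi: "continuous_on A (\<lambda>y :: ('n, 'd) state. \<phi> (norm (agent y j - agent y i)))" for i j
    by (rule continuous_on_compose2[OF phi_continuous])
      (auto simp: agent_def[abs_def] intro!: continuous_intros continuous_on_vec_lambda)
  have "continuous_on A (\<lambda>y :: ('n, 'd) state. laplacian k \<phi> y *v y)"
    by (rule continuous_on_vec_lambda[of A "\<lambda>p y. (laplacian k \<phi> y *v y) $ p", simplified])
      (auto simp: split_paired_all laplacian_mult_nth intro!: continuous_intros phi)
  then show ?thesis
    unfolding drift_eq[abs_def] by (intro continuous_intros)
qed

lemma measurable_drift[measurable]: "drift \<in> borel_measurable borel"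
  by (intro borel_measurable_continuous_onI continuous_drift)

lemma trajectories_eq:
  "trajectories M h k \<phi> x0 w = {network h k \<phi> x v | x v. x \<in> msupp initial_law \<and> (\<forall>t. v t \<in> msupp noise_law)}"
  unfolding trajectories_def distr_disagreement_w initial_law_def ..

lemma states_eq:
  "states = {network h k \<phi> x v t | x v t. x \<in> msupp initial_law \<and> (\<forall>t. v t \<in> msupp noise_law)}"
  (is "_ = ?R")
proof
  show "states \<subseteq> ?R"
    unfolding state_space_def trajectories_eq by fast
  show "?R \<subseteq> states"
  proof
    fix y assume "y \<in> ?R"
    then obtain x v t where "x \<in> msupp initial_law" "\<forall>t. v t \<in> msupp noise_law" and y: "y = network h k \<phi> x v t"
      by blast
    then have "network h k \<phi> x v \<in> trajectories M h k \<phi> x0 w"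
      unfolding trajectories_eq by blast
    then show "y \<in> states"
      unfolding state_space_def y by blast
  qed
qed

text \<open>The value \<open>v\<close> is spliced into the noise sequence at time \<open>t\<close>.
  The state at time \<open>t\<close> depends on earlier noise only, so it is unaffected.\<close>

lemma states_step:
  assumes "y \<in> states" "v \<in> msupp noise_law"
  shows "drift y + h *\<^sub>R v \<in> states"
proof -
  obtain x u t where x: "x \<in> msupp initial_law" "\<And>t. u t \<in> msupp noise_law" and y: "y = network h k \<phi> x u t"
    using assms(1) unfolding states_eq by blast
  have "drift y + h *\<^sub>R v = network h k \<phi> x (u(t := v)) (Suc t)"
    unfolding network_Suc y using network_cong[of t u "u(t := v)" x] by simp
  moreover have "\<forall>s. (u(t := v)) s \<in> msupp noise_law"
    using x assms(2) by simp
  ultimately show ?thesis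
    unfolding states_eq using x(1) by blast
qed

lemma msupp_law:
  fixes X :: "'a \<Rightarrow> ('n, 'd) state"
  assumes [measurable]: "X \<in> borel_measurable M" and "AE \<omega> in M. norm (X \<omega>) \<le> B"
  shows "msupp (distr M borel (\<lambda>\<omega>. disagreement (X \<omega>))) \<subseteq> consensus\<^sup>\<bottom> \<inter> cball 0 B"
proof -
  define C :: "('n, 'd) state set" where "C = consensus\<^sup>\<bottom> \<inter> cball 0 B"
  have C: "closed C"
    unfolding C_def by (intro closed_Int closed_subspace subspace_orthogonal_comp closed_cball)
  have "AE \<omega> in M. disagreement (X \<omega>) \<in> C"
    using assms(2)
    by eventually_elim (auto simp: C_def disagreement_in intro: order_trans[OF norm_disagreement_le])
  then have "AE x in distr M borel (\<lambda>\<omega>. disagreement (X \<omega>)). x \<in> C"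
    using borel_closed[OF C] by (subst AE_distr_iff) auto
  then have "msupp (distr M borel (\<lambda>\<omega>. disagreement (X \<omega>))) \<subseteq> C"
    by (intro msupp_subset_closed C) simp
  then show ?thesis by (simp add: C_def)
qed

lemma msupp_noise: "msupp noise_law \<subseteq> consensus\<^sup>\<bottom> \<inter> cball 0 W" "msupp noise_law \<noteq> {}"
  unfolding noise_law_def by (rule msupp_law, simp, rule w_bounded) (rule msupp_nonempty, simp)

lemma msupp_initial: "msupp initial_law \<subseteq> consensus\<^sup>\<bottom> \<inter> cball 0 R\<^sub>0" "msupp initial_law \<noteq> {}"
  unfolding initial_law_def by (rule msupp_law, simp, rule x0_bounded) (rule msupp_nonempty, simp)

lemma states_nonempty: "states \<noteq> {}"
proof -
  obtain x v where "x \<in> msupp initial_law" "v \<in> msupp noise_law"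
    using msupp_initial(2) msupp_noise(2) by blast
  then have "network h k \<phi> x (\<lambda>_. v) 0 \<in> states" unfolding states_eq by blast
  then show ?thesis by blast
qed

lemma states_induct [consumes 1, case_names initial step]:
  assumes "y \<in> states"
    and "\<And>x. x \<in> msupp initial_law \<Longrightarrow> Q x"
    and "\<And>x v. x \<in> states \<Longrightarrow> Q x \<Longrightarrow> v \<in> msupp noise_law \<Longrightarrow> Q (drift x + h *\<^sub>R v)"
  shows "Q y"
proof -
  obtain x u t where x: "x \<in> msupp initial_law" "\<And>t. u t \<in> msupp noise_law" and y: "y = network h k \<phi> x u t"
    using assms(1) unfolding states_eq by blast
  have "Q (network h k \<phi> x u t)"
  proof (induction t)
    case (Suc t)
    have "network h k \<phi> x u t \<in> states" unfolding states_eq using x by blast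
    with Suc x(2) show ?case unfolding network_Suc by (intro assms(3))
  qed (use x assms(2) in simp)
  then show ?thesis by (simp add: y)
qed

lemma states_orthogonal: "states \<subseteq> consensus\<^sup>\<bottom>"
proof
  fix y assume "y \<in> states"
  then show "y \<in> consensus\<^sup>\<bottom>"
  proof (induction rule: states_induct)
    case (step x v)
    then show ?case
      using msupp_noise by (intro subspace_add subspace_scale subspace_orthogonal_comp drift_orthogonal) auto
  qed (use msupp_initial in auto)
qed

text \<open>The states reachable at a fixed time form a compact set, as the continuous image of the
  previous one and the compact noise support; the state space is their countable union.\<close>

lemma states_borel[measurable]: "states \<in> sets borel"
proof -
  define reach where "reach t = {network h k \<phi> x v t | x v. x \<in> msupp initial_law \<and> (\<forall>t. v t \<in> msupp noise_law)}" for t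
  have "compact (reach t)" for t
  proof (induction t)
    case 0
    \<comment> \<open>Even at time 0 a noise sequence is quantified over, so the noise support has
      to be nonempty.\<close>
    obtain v where "v \<in> msupp noise_law" using msupp_noise by blast
    then have "reach 0 = msupp initial_law"
      by (auto simp: reach_def intro!: exI[of _ "\<lambda>_. v"])
    moreover have "bounded (msupp initial_law)"
      using msupp_initial(1) by (auto intro: bounded_subset[OF bounded_cball])
    ultimately show ?case
      by (simp add: compact_eq_bounded_closed closed_msupp)
  next
    case (Suc t)
    have "reach (Suc t) = (\<lambda>(y, v). drift y + h *\<^sub>R v) ` (reach t \<times> msupp noise_law)" (is "_ = ?R")
    proof
      show "reach (Suc t) \<subseteq> ?R"
        unfolding reach_def network_Suc by fast
      show "?R \<subseteq> reach (Suc t)"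
      proof clarify
        fix y v assume "y \<in> reach t" and v: "v \<in> msupp noise_law"
        then obtain x u where x: "x \<in> msupp initial_law" "\<And>t. u t \<in> msupp noise_law" and y: "y = network h k \<phi> x u t"
          unfolding reach_def by blast
        have "drift y + h *\<^sub>R v = network h k \<phi> x (u(t := v)) (Suc t)"
          unfolding network_Suc y using network_cong[of t u "u(t := v)" x] by simp
        moreover have "\<forall>s. (u(t := v)) s \<in> msupp noise_law" using x v by simp
        ultimately show "drift y + h *\<^sub>R v \<in> reach (Suc t)"
          unfolding reach_def using x(1) by blast
      qed
    qed
    moreover have "compact (msupp noise_law)"
      using msupp_noise(1) by (auto simp: compact_eq_bounded_closed closed_msupp intro: bounded_subset[OF bounded_cball])
    moreover have "continuous_on A (\<lambda>(y, v). drift y + h *\<^sub>R v)" for A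
      unfolding split_beta
      by (intro continuous_intros continuous_on_compose2[OF continuous_drift[of UNIV]]) auto
    ultimately show ?case
      using Suc by (simp add: compact_Times compact_continuous_image)
  qed
  then have "(\<Union>t. reach t) \<in> sets borel"
    by (intro sets.countable_UN) (auto intro: borel_compact)
  moreover have "states = (\<Union>t. reach t)"
    unfolding states_eq reach_def by blast
  ultimately show ?thesis by simp
qed

section \<open>Contraction and boundedness of the state space\<close>

text \<open>A real supremum has no useful value on a set that is not bounded above. The bound
  \<open>S\<^sub>0\<close> on the coupling gives entries, and hence eigenvalues, bounded uniformly
  in the state, so that the hypothesis on \<zeta> says something about each single state.\<close>

lemma eigenvalues_laplacian_bounded:
  obtains B where "\<And>x l. l \<in> eigenvalues (laplacian k \<phi> (x :: ('n, 'd) state)) \<Longrightarrow> \<bar>l\<bar> \<le> B"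
proof -
  define C where "C = (\<Sum>i\<in>UNIV. \<Sum>j\<in>UNIV. k i j * S\<^sub>0)"
  have S\<^sub>0: "0 \<le> S\<^sub>0" using phi_pos[of 0] phi_bounded[of 0] by simp
  have row: "(\<Sum>l\<in>UNIV. k i l * S\<^sub>0) \<le> C" for i
    unfolding C_def
    by (rule member_le_sum[where f="\<lambda>i. \<Sum>j\<in>UNIV. k i j * S\<^sub>0"])
      (auto intro!: sum_nonneg mult_nonneg_nonneg S\<^sub>0 k_nonneg)
  have phi: "0 \<le> \<phi> (norm z)" "\<phi> (norm z) \<le> S\<^sub>0" for z :: "real ^ 'd"
    using phi_pos[of "norm z"] phi_bounded[of "norm z"] by auto
  have entry: "\<bar>laplacian k \<phi> x $ p $ q\<bar> \<le> C" for x :: "('n, 'd) state" and p q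
  proof -
    let ?c = "\<lambda>l. k (fst p) l * \<phi> (norm (agent x l - agent x (fst p)))"
    have c: "0 \<le> ?c l" "?c l \<le> k (fst p) l * S\<^sub>0" for l
      by (intro mult_nonneg_nonneg mult_left_mono phi k_nonneg)+
    have "sum ?c UNIV \<le> C"
      using sum_mono[of UNIV ?c "\<lambda>l. k (fst p) l * S\<^sub>0", OF c(2)] row[of "fst p"] by (rule order_trans)
    moreover have "?c l \<le> sum ?c UNIV" for l
      by (rule member_le_sum[where f="?c"]) (use c(1) in auto)
    moreover have "0 \<le> sum ?c UNIV"
      by (rule sum_nonneg) (rule c(1))
    ultimately have "\<bar>if fst p = fst q then sum ?c UNIV else - ?c (fst q)\<bar> \<le> C" "0 \<le> C"
      using c(1)[of "fst q"] order_trans[of "?c (fst q)" "sum ?c UNIV" C] by auto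
    moreover have "laplacian k \<phi> x $ p $ q =
        (if fst p = fst q then sum ?c UNIV else - ?c (fst q)) * (if snd p = snd q then 1 else 0)"
      by (simp add: laplacian_def Let_def mat_def)
    ultimately show ?thesis by (cases "snd p = snd q") auto
  qed
  show thesis
  proof
    fix x :: "('n, 'd) state" and l assume "l \<in> eigenvalues (laplacian k \<phi> x)"
    then obtain v where v: "v \<noteq> 0" "laplacian k \<phi> x *v v = l *\<^sub>R v"
      by (auto simp: eigenvalues_def)
    have "\<bar>l\<bar> * norm v = norm (laplacian k \<phi> x *v v)" by (simp add: v)
    also have "\<dots> \<le> onorm ((*v) (laplacian k \<phi> x)) * norm v"
      by (intro onorm) (simp add: matrix_vector_mul_bounded_linear)
    also have "\<dots> \<le> (real CARD('n \<times> 'd) * real CARD('n \<times> 'd) * C) * norm v"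
      by (intro mult_right_mono onorm_le_matrix_component entry) simp
    finally show "\<bar>l\<bar> \<le> real CARD('n \<times> 'd) * real CARD('n \<times> 'd) * C"
      using v by simp
  qed
qed

text \<open>The eigenvalue from \<open>contraction_eigenvalue\<close> lies between
  \<open>lambda_2\<close> and \<open>lambda_max\<close>, and the convex function
  \<open>\<bar>1 - h * l\<bar>\<close> of \<open>l\<close> is largest at an end of that interval,
  where \<zeta> bounds it.\<close>

lemma drift_contracting:
  obtains c where "0 \<le> c" "c < 1" "\<And>y. y \<in> states \<Longrightarrow> norm (drift y) \<le> c * norm y"
proof -
  let ?L = "\<lambda>x :: ('n, 'd) state. laplacian k \<phi> x"
  let ?z = "\<lambda>x. max \<bar>1 - h * lambda_2 (?L x)\<bar> \<bar>1 - h * lambda_max (?L x)\<bar>"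
  let ?T = "trajectories M h k \<phi> x0 w \<times> (UNIV :: nat set)"
  define \<zeta> where "\<zeta> = (SUP (x, t) \<in> ?T. ?z (x t))"
  \<comment> \<open>Taking \<open>max 0 \<zeta>\<close> makes the constant nonnegative also when
    \<open>0\<close> is the only state and nothing is known about \<zeta> from below.\<close>
  have "norm (drift y) \<le> max 0 \<zeta> * norm y" if y: "y \<in> states" for y
  proof (cases "y = 0")
    case True
    then show ?thesis by (simp add: drift_def)
  next
    case False
    have y': "y \<in> consensus\<^sup>\<bottom>" using y states_orthogonal by auto
    \<comment> \<open>A nonzero vector of the complement forces a nonzero eigenvalue at every
      \<open>x\<close>, so \<open>lambda_2\<close> is never the minimum of an empty set.\<close>
    have ne: "eigenvalues (?L x) - {0} \<noteq> {}" for x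
      using contraction_eigenvalue[OF y' False, of x] by blast
    have "lambda_2 (?L x) \<in> eigenvalues (?L x)" for x
      using Min_in[OF finite_Diff[OF finite_eigenvalues_laplacian] ne[of x]] by (simp add: lambda_2_def)
    moreover have "lambda_max (?L x) \<in> eigenvalues (?L x)" for x
      unfolding lambda_max_def using ne[of x] by (intro Max_in finite_eigenvalues_laplacian) auto
    moreover obtain B where "\<And>x l. l \<in> eigenvalues (?L x) \<Longrightarrow> \<bar>l\<bar> \<le> B"
      using eigenvalues_laplacian_bounded by blast
    ultimately have "\<bar>h * lambda_2 (?L x)\<bar> \<le> h * B" "\<bar>h * lambda_max (?L x)\<bar> \<le> h * B" for x
      using h_pos by (auto simp: abs_mult)
    then have "?z x \<le> 1 + h * B" for x
      by (intro max.boundedI order_trans[OF abs_triangle_ineq4]) auto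
    then have bdd: "bdd_above ((\<lambda>(x, t). ?z (x t)) ` ?T)"
      by (intro bdd_aboveI[of _ "1 + h * B"]) auto
    obtain x t where x: "x \<in> trajectories M h k \<phi> x0 w" "y = x t"
      using y unfolding state_space_def by blast
    have "?z y \<le> \<zeta>"
      unfolding \<zeta>_def using x by (intro cSUP_upper2[OF bdd, of "(x, t)"]) auto
    obtain l where l: "l \<in> eigenvalues (?L y) - {0}" "norm (drift y) \<le> \<bar>1 - h * l\<bar> * norm y"
      using contraction_eigenvalue[OF y' False, of y] y' unfolding drift_def by metis
    have "h * lambda_2 (?L y) \<le> h * l" "h * l \<le> h * lambda_max (?L y)"
      using l(1) h_pos finite_eigenvalues_laplacian[of y] by (auto simp: lambda_2_def lambda_max_def)
    then have "\<bar>1 - h * l\<bar> \<le> ?z y" by linarith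
    then have "\<bar>1 - h * l\<bar> \<le> max 0 \<zeta>" using \<open>?z y \<le> \<zeta>\<close> by linarith
    then show ?thesis
      using l(2) by (meson mult_right_mono norm_ge_zero order_trans)
  qed
  moreover have "\<zeta> < 1" using zeta_less_1 by (simp add: \<zeta>_def)
  ultimately show thesis by (intro that[of "max 0 \<zeta>"]) auto
qed

lemma states_bounded:
  obtains R where "0 \<le> R" "\<And>y. y \<in> states \<Longrightarrow> norm y \<le> R"
proof -
  obtain c where c: "0 \<le> c" "c < 1" "\<And>y. y \<in> states \<Longrightarrow> norm (drift y) \<le> c * norm y"
    using drift_contracting by blast
  \<comment> \<open>\<open>h * W / (1 - c)\<close> is the fixed point of
    \<open>r \<mapsto> c * r + h * W\<close>, the worst growth of the norm in one step; any larger
    radius is preserved.\<close>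
  define R where "R = max 0 (max R\<^sub>0 (h * W / (1 - c)))"
  have "h * W / (1 - c) \<le> R" by (simp add: R_def)
  then have R: "c * R + h * W \<le> R"
    using c by (simp add: pos_divide_le_eq algebra_simps)
  show thesis
  proof
    show "0 \<le> R" by (simp add: R_def)
    fix y assume "y \<in> states"
    then show "norm y \<le> R"
    proof (induction rule: states_induct)
      case (initial x)
      then show ?case using msupp_initial(1) by (auto simp: R_def)
    next
      case (step x v)
      have "norm (drift x + h *\<^sub>R v) \<le> norm (drift x) + h * norm v"
        using norm_triangle_ineq[of "drift x" "h *\<^sub>R v"] h_pos by simp
      also have "norm (drift x) \<le> c * R"
        using c(1) c(3)[OF step.hyps(1)] step.IH by (meson mult_left_mono order_trans)
      also have "h * norm v \<le> h * W"
        using msupp_noise(1) step.hyps(2) h_pos by auto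
      finally show ?case using R by simp
    qed
  qed
qed

section \<open>The transition kernel\<close>

lemma measurable_step[measurable]: "(\<lambda>(y, v). drift y + h *\<^sub>R v) \<in> borel \<Otimes>\<^sub>M borel \<rightarrow>\<^sub>M borel"
  by measurable

lemma step_kernel_measurable[measurable]: "step_kernel \<in> borel \<rightarrow>\<^sub>M prob_algebra borel"
  unfolding step_kernel_def[abs_def]
  by (rule measurable_distr_prob_space2[where M=borel])
    (auto simp: space_prob_algebra prob_space_noise_law intro!: measurable_const)

lemma prob_space_step_kernel: "prob_space (step_kernel y)"
  using measurable_space[OF step_kernel_measurable, of y] by (simp add: space_prob_algebra)

lemma sets_step_kernel[simp, measurable_cong]: "sets (step_kernel y) = sets borel"
  by (simp add: step_kernel_def)

text \<open>Stated on the product over the first \<open>t\<close> indices, so that the state at time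
  \<open>t\<close> becomes a function of a restricted noise sequence, the form in which independence
  of disjoint index blocks is available.\<close>

lemma network_prefix_measurable:
  fixes x :: "('n, 'd) state"
  shows "s \<le> t \<Longrightarrow> (\<lambda>v. network h k \<phi> x v s) \<in> PiM {..<t} (\<lambda>_. borel) \<rightarrow>\<^sub>M borel"
proof (induction s)
  case (Suc s)
  then have s: "(\<lambda>v. network h k \<phi> x v s) \<in> PiM {..<t} (\<lambda>_. borel) \<rightarrow>\<^sub>M borel" by simp
  have v: "(\<lambda>v. v s) \<in> PiM {..<t} (\<lambda>_. borel) \<rightarrow>\<^sub>M borel"
    using Suc.prems by (intro measurable_component_singleton) simp
  show ?case
    unfolding network_Suc
    by (intro borel_measurable_add borel_measurable_scaleR measurable_const measurable_compose[OF s measurable_drift] v) simp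
qed simp

lemma indep_network_noise:
  "indep_var borel (\<lambda>\<omega>. network h k \<phi> x (\<lambda>s. disagreement (w s \<omega>)) t) borel (\<lambda>\<omega>. disagreement (w t \<omega>))"
proof -
  let ?V = "\<lambda>s \<omega>. disagreement (w s \<omega>)"
  have "indep_vars (\<lambda>_. borel) ?V UNIV"
    by (rule indep_vars_compose2[OF w_indep]) simp
  then have "indep_var (PiM {..<t} (\<lambda>_. borel)) (\<lambda>\<omega>. restrict (\<lambda>s. ?V s \<omega>) {..<t})
      (PiM {t} (\<lambda>_. borel)) (\<lambda>\<omega>. restrict (\<lambda>s. ?V s \<omega>) {t})"
    by (rule indep_var_restrict) auto
  then have "indep_var borel ((\<lambda>v. network h k \<phi> x v t) \<circ> (\<lambda>\<omega>. restrict (\<lambda>s. ?V s \<omega>) {..<t}))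
      borel ((\<lambda>v. v t) \<circ> (\<lambda>\<omega>. restrict (\<lambda>s. ?V s \<omega>) {t}))"
    by (rule indep_var_compose) (auto intro: network_prefix_measurable)
  moreover have "network h k \<phi> x (restrict (\<lambda>s. ?V s \<omega>) {..<t}) t = network h k \<phi> x (\<lambda>s. ?V s \<omega>) t" for \<omega>
    by (rule network_cong) simp
  ultimately show ?thesis by (simp add: comp_def)
qed

lemma transition_0: "P 0 x = return borel x"
proof (rule measure_eqI)
  fix A assume "A \<in> sets (P 0 x)"
  then show "emeasure (P 0 x) A = emeasure (return borel x) A"
    by (simp add: transition_def emeasure_distr emeasure_space_1 indicator_def)
qed (simp add: transition_def)

text \<open>The Markov property: the noise at time \<open>t\<close> is independent of the state at
  time \<open>t\<close>, and identical distribution over time makes the kernel the same at each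
  step.\<close>

lemma transition_Suc: "P (Suc t) x = P t x \<bind> step_kernel"
  unfolding transition_def network_Suc
  by (subst distr_indep_var_eq_bind[OF indep_network_noise measurable_step])
    (simp add: step_kernel_def[abs_def] distr_disagreement_w)

lemma transition_kernel[measurable]: "P t \<in> borel \<rightarrow>\<^sub>M prob_algebra borel"
proof (induction t)
  case 0
  then show ?case by (simp add: transition_0[abs_def])
next
  case (Suc t)
  then show ?case
    unfolding transition_Suc[abs_def] by (rule measurable_bind_prob_space) simp
qed

lemma prob_space_transition: "prob_space (P t x)"
  using measurable_space[OF transition_kernel, of x t] by (simp add: space_prob_algebra)

lemma sets_transition[simp, measurable_cong]: "sets (P t x) = sets borel"
  by (simp add: transition_def)

lemma transition_add: "P (s + t) x = P s x \<bind> P t"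
proof (induction t)
  case 0
  then show ?case by (simp add: transition_0[abs_def] bind_return'')
next
  case (Suc t)
  have "P (s + Suc t) x = (P s x \<bind> P t) \<bind> step_kernel"
    by (simp add: transition_Suc Suc)
  also have "\<dots> = P s x \<bind> (\<lambda>y. P t y \<bind> step_kernel)"
    by (rule bind_assoc[where N=borel and R=borel])
      (auto intro!: measurable_prob_algebraD simp: measurable_cong_sets[OF sets_transition refl])
  finally show ?case by (simp add: transition_Suc[abs_def])
qed

lemma AE_noise_states:
  assumes "y \<in> states"
  shows "AE z in step_kernel y. z \<in> states"
  unfolding step_kernel_def using AE_msupp[OF sets_noise_law]
  by (subst AE_distr_iff) (auto elim!: eventually_mono intro: states_step assms)

lemma AE_transition_states:
  assumes "x \<in> states"
  shows "AE y in P t x. y \<in> states"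
proof (induction t)
  case 0
  show ?case
    unfolding transition_0 using assms by (subst AE_return) auto
next
  case (Suc t)
  have "(AE y in P t x \<bind> step_kernel. y \<in> states) \<longleftrightarrow> (AE y in P t x. AE z in step_kernel y. z \<in> states)"
    by (rule AE_bind[where B=borel])
      (auto intro!: measurable_prob_algebraD simp: measurable_cong_sets[OF sets_transition refl])
  moreover have "AE y in P t x. AE z in step_kernel y. z \<in> states"
    using Suc by eventually_elim (rule AE_noise_states)
  ultimately show ?case unfolding transition_Suc by simp
qed

section \<open>Uniform minorization of the transition kernel\<close>

text \<open>Conditioning on a visit to \<open>B\<close> at time \<open>t\<close> chains lower
  bounds. It serves twice: for the repeated approach to \<open>0\<close>, and for the single
  minorizing step after it.\<close>

lemma transition_Suc_ge:
  assumes x: "x \<in> states" and [measurable]: "A \<in> sets borel" "B \<in> sets borel"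
    and "\<And>y. y \<in> states \<Longrightarrow> y \<in> B \<Longrightarrow> p \<le> measure (step_kernel y) A"
  shows "p * measure (P t x) B \<le> measure (P (Suc t) x) A"
proof -
  interpret Q: prob_space "P t x" by (rule prob_space_transition)
  have K: "step_kernel \<in> P t x \<rightarrow>\<^sub>M subprob_algebra borel"
    by (auto intro!: measurable_prob_algebraD simp: measurable_cong_sets[OF sets_transition refl])
  have le1: "measure (step_kernel y) A \<le> 1" for y
    by (rule prob_space.prob_le_1[OF prob_space_step_kernel])
  have "p * measure (P t x) B = (\<integral>y. p * indicator B y \<partial>P t x)"
    using sets_eq_imp_space_eq[OF sets_transition[of t x]] by simp
  also have "\<dots> \<le> (\<integral>y. measure (step_kernel y) A \<partial>P t x)"
  proof (rule integral_mono_AE)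
    show "AE y in P t x. p * indicator B y \<le> measure (step_kernel y) A"
      using AE_transition_states[OF x, of t]
    proof eventually_elim
      case (elim y)
      then show ?case using assms(4)[of y] by (auto simp: indicator_def)
    qed
    show "integrable (P t x) (\<lambda>y. measure (step_kernel y) A)"
      by (rule Q.integrable_const_bound[where B=1]) (auto simp: le1)
  qed (auto simp: Q.emeasure_eq_measure intro!: integrable_mult_right)
  also have "\<dots> = measure (P (Suc t) x) A"
    unfolding transition_Suc
    by (rule subprob_space.measure_bind[symmetric, where N=borel])
      (use K Q.prob_space_axioms in \<open>auto intro: prob_space_imp_subprob_space\<close>)
  finally show ?thesis .
qed

text \<open>
  The agents' noises are independent with a common law, so they are simultaneously close to one
  point of its support; the projection annihilates the consensus vector of that point.
\<close>

lemma small_noise: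
  assumes "0 < s"
  shows "0 < measure noise_law (cball 0 s)"
proof -
  let ?X = "\<lambda>i \<omega>. agent (w 0 \<omega>) i"
  have [measurable]: "?X i \<in> borel_measurable M" for i
    using w_entries_iid[of 0] by (simp add: iid_def indep_vars_def)
  define i\<^sub>0 :: 'n where "i\<^sub>0 = undefined"
  have same: "distr M borel (?X i) = distr M borel (?X i\<^sub>0)" for i
    using w_entries_iid[of 0] unfolding iid_def by blast
  obtain u where u: "u \<in> msupp (distr M borel (?X i\<^sub>0))"
    using msupp_nonempty[of "?X i\<^sub>0"] by auto
  \<comment> \<open>Compensates for the cardinality lost in
    \<open>norm_disagreement_le_agents\<close>.\<close>
  define r where "r = s / real CARD('n \<times> 'd)"
  have r: "0 < r" using assms by (simp add: r_def)
  have "0 < prob (?X i -` ball u r \<inter> space M)" for i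
  proof -
    have "0 < emeasure (distr M borel (?X i)) (ball u r)"
      using u r unfolding same[of i] msupp_def by auto
    then show ?thesis by (simp add: emeasure_distr emeasure_eq_measure)
  qed
  then have "0 < (\<Prod>i\<in>UNIV. prob (?X i -` ball u r \<inter> space M))"
    by (intro prod_pos) simp
  also have "\<dots> = prob (\<Inter>i\<in>UNIV. ?X i -` ball u r \<inter> space M)"
    using w_entries_iid[of 0] by (intro indep_varsD[symmetric]) (auto simp: iid_def)
  also have "\<dots> \<le> prob ((\<lambda>\<omega>. disagreement (w 0 \<omega>)) -` cball 0 s \<inter> space M)"
  proof (rule finite_measure_mono)
    show "(\<Inter>i\<in>UNIV. ?X i -` ball u r \<inter> space M) \<subseteq> (\<lambda>\<omega>. disagreement (w 0 \<omega>)) -` cball 0 s \<inter> space M"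
    proof
      fix \<omega> assume \<omega>: "\<omega> \<in> (\<Inter>i\<in>UNIV. ?X i -` ball u r \<inter> space M)"
      then have "norm (disagreement (w 0 \<omega>)) \<le> real CARD('n \<times> 'd) * r"
        by (intro norm_disagreement_le_agents[where u=u]) (auto simp: dist_commute less_imp_le)
      then show "\<omega> \<in> (\<lambda>\<omega>. disagreement (w 0 \<omega>)) -` cball 0 s \<inter> space M"
        using \<omega> by (auto simp: r_def)
    qed
  qed measurable
  also have "\<dots> = measure noise_law (cball 0 s)"
    by (simp add: noise_law_def measure_distr)
  finally show ?thesis .
qed

lemma step_kernel_minorization:
  obtains c r z where "0 < c" "0 < r"
    "\<And>y A. y \<in> consensus\<^sup>\<bottom> \<Longrightarrow> norm (drift y) \<le> r \<Longrightarrow> A \<in> sets borel \<Longrightarrow>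
      c * measure lborel (ball z r \<inter> disagreement -` A) \<le> measure (step_kernel y) A"
proof -
  obtain f where f: "\<And>z. 0 \<le> f z" "lower_semicontinuous f" "distributed M lborel (w 0) (\<lambda>z. ennreal (f z))"
    using w_density[of 0] by blast
  have f_meas[measurable]: "(\<lambda>z. ennreal (f z)) \<in> borel_measurable borel"
    using distributed_borel_measurable[OF f(3)] by simp
  have law: "emeasure M (w 0 -` B \<inter> space M) = (\<integral>\<^sup>+ z. ennreal (f z) * indicator B z \<partial>lborel)" if "B \<in> sets borel" for B
    using distributed_emeasure[OF f(3), of B] that by simp
  obtain z\<^sub>0 where z\<^sub>0: "0 < f z\<^sub>0"
  proof (rule ccontr)
    assume "\<not> thesis"
    have "f z = 0" for z
    proof (rule ccontr)
      assume "f z \<noteq> 0"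
      then have "0 < f z" using f(1)[of z] by simp
      then show False using that[of z] \<open>\<not> thesis\<close> by blast
    qed
    then have "emeasure M (space M) = 0" using law[of UNIV] by simp
    then show False by (simp add: emeasure_space_1)
  qed
  \<comment> \<open>Strictly below \<open>f z\<^sub>0\<close>, so that lower semicontinuity yields
    an open neighbourhood on which the density exceeds it.\<close>
  define c\<^sub>0 where "c\<^sub>0 = f z\<^sub>0 / 2"
  have c\<^sub>0: "0 < c\<^sub>0" "c\<^sub>0 < f z\<^sub>0" using z\<^sub>0 by (auto simp: c\<^sub>0_def)
  have "open {z. c\<^sub>0 < f z}" using f(2) by (simp add: lower_semicontinuous_def)
  then obtain d where d: "0 < d" "ball z\<^sub>0 d \<subseteq> {z. c\<^sub>0 < f z}"
    using c\<^sub>0 by (auto simp: open_contains_ball)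
  define N where "N = DIM(('n, 'd) state)"
  \<comment> \<open>Half of \<open>h * d\<close> is spent on the shift by \<open>drift y\<close> and
    half on the distance to \<open>z\<close>; thus \<open>u\<close> stays within \<open>d\<close> of
    \<open>z\<^sub>0\<close> while the centre \<open>z\<close> does not depend on
    \<open>y\<close>.\<close>
  define r where "r = h * d / 2"
  define z where "z = h *\<^sub>R z\<^sub>0"
  show thesis
  proof
    show "0 < c\<^sub>0 / h ^ N" "0 < r" using c\<^sub>0 d h_pos by (auto simp: r_def)
    fix y A assume y: "y \<in> consensus\<^sup>\<bottom>" "norm (drift y) \<le> r" and A[measurable]: "A \<in> sets (borel :: ('n, 'd) state measure)"
    define T where "T u = drift y + h *\<^sub>R u" for u
    have [measurable]: "T \<in> borel_measurable borel" unfolding T_def[abs_def] by measurable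
    define C where "C = ball z r \<inter> disagreement -` A"
    have C[measurable]: "C \<in> sets borel"
      unfolding C_def using measurable_sets[OF measurable_disagreement A] by (intro sets.Int) auto
    have TC[measurable]: "T -` C \<in> sets borel"
      using measurable_sets[of T borel borel C] by simp
    have near: "c\<^sub>0 \<le> f u" if "T u \<in> C" for u
    proof -
      have "h * dist z\<^sub>0 u = norm (z - T u + drift y)"
        using h_pos by (simp add: T_def z_def dist_norm flip: scaleR_diff_right)
      also have "\<dots> \<le> dist z (T u) + norm (drift y)"
        unfolding dist_norm by (rule norm_triangle_ineq)
      also have "\<dots> < r + r" using that y(2) by (auto simp: C_def)
      finally have "dist z\<^sub>0 u < d" using h_pos by (simp add: r_def)
      then show ?thesis using d(2) by (auto intro: less_imp_le)
    qed
    have fin: "emeasure lborel C < \<infinity>"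
      using emeasure_mono[of C "ball z r" lborel] emeasure_lborel_ball_finite[of z r] by (auto simp: C_def intro: le_less_trans)
    have "ennreal c\<^sub>0 * emeasure lborel (T -` C) = (\<integral>\<^sup>+ u. ennreal c\<^sub>0 * indicator (T -` C) u \<partial>lborel)"
      by (simp add: nn_integral_cmult_indicator)
    also have "\<dots> \<le> (\<integral>\<^sup>+ u. ennreal (f u) * indicator (T -` C) u \<partial>lborel)"
      using near by (intro nn_integral_mono) (auto simp: indicator_def intro!: ennreal_leI)
    also have "\<dots> = emeasure M (w 0 -` (T -` C) \<inter> space M)"
      by (simp add: law)
    also have "\<dots> \<le> emeasure M {\<omega>\<in>space M. drift y + h *\<^sub>R disagreement (w 0 \<omega>) \<in> A}"
    proof (rule emeasure_mono)
      have "disagreement (T u) = drift y + h *\<^sub>R disagreement u" for u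
        using disagreement_ident[OF drift_orthogonal[OF y(1)]]
        by (simp add: T_def linear_add[OF linear_disagreement] linear_scale[OF linear_disagreement])
      then show "w 0 -` (T -` C) \<inter> space M \<subseteq> {\<omega>\<in>space M. drift y + h *\<^sub>R disagreement (w 0 \<omega>) \<in> A}"
        by (auto simp: C_def)
    qed measurable
    also have "\<dots> = emeasure (step_kernel y) A"
      unfolding step_kernel_def noise_law_def
      by (subst distr_distr) (auto simp: emeasure_distr comp_def vimage_def Int_def conj_commute intro!: arg_cong[where f="emeasure M"])
    finally have "ennreal c\<^sub>0 * emeasure lborel (T -` C) \<le> emeasure (step_kernel y) A" .
    \<comment> \<open>Change of variables under the affine map \<open>T\<close>, in the dimension
      \<open>N\<close> of the full space; this is where the factor \<open>1 / h ^ N\<close> comes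
      from.\<close>
    moreover have "emeasure lborel C = ennreal (h ^ N) * emeasure lborel (T -` C)"
    proof -
      have "emeasure lborel C = emeasure (density (distr lborel borel T) (\<lambda>_. ennreal (h ^ N))) C"
        using lborel_affine[of h "drift y"] h_pos unfolding T_def[abs_def] N_def by simp
      also have "\<dots> = ennreal (h ^ N) * emeasure lborel (T -` C)"
        by (subst emeasure_density_const) (auto simp: emeasure_distr)
      finally show ?thesis .
    qed
    ultimately have "ennreal (c\<^sub>0 / h ^ N) * emeasure lborel C \<le> emeasure (step_kernel y) A"
      using h_pos c\<^sub>0 by (simp add: mult.assoc[symmetric] flip: ennreal_mult)
    moreover have nonneg: "0 \<le> c\<^sub>0 / h ^ N"
      using h_pos c\<^sub>0 by simp
    moreover have "emeasure lborel C = ennreal (measure lborel C)"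
      using fin by (intro emeasure_eq_ennreal_measure) simp
    moreover have "emeasure (step_kernel y) A = ennreal (measure (step_kernel y) A)"
      by (rule finite_measure.emeasure_eq_measure[OF prob_space.axioms(1)[OF prob_space_step_kernel]])
    ultimately have "ennreal (c\<^sub>0 / h ^ N * measure lborel C) \<le> ennreal (measure (step_kernel y) A)"
      by (simp only: ennreal_mult'[OF nonneg])
    then have "c\<^sub>0 / h ^ N * measure lborel C \<le> measure (step_kernel y) A"
      by (simp only: ennreal_le_iff measure_nonneg)
    then show "c\<^sub>0 / h ^ N * measure lborel (ball z r \<inter> disagreement -` A) \<le> measure (step_kernel y) A"
      by (simp add: C_def)
  qed
qed

lemma transition_near_zero:
  assumes "0 < r"
  obtains m p where "0 < p" "\<And>x. x \<in> states \<Longrightarrow> p \<le> measure (P m x) (cball 0 r)"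
proof -
  obtain c where c: "0 \<le> c" "c < 1" "\<And>y. y \<in> states \<Longrightarrow> norm (drift y) \<le> c * norm y"
    using drift_contracting by blast
  obtain R where R: "0 \<le> R" "\<And>y. y \<in> states \<Longrightarrow> norm y \<le> R"
    using states_bounded by blast
  \<comment> \<open>Chosen so that \<open>r / 2\<close> is the fixed point of
    \<open>x \<mapsto> c * x + s\<close>: with every scaled noise term of norm at most
    \<open>s\<close>, the norm decays to \<open>r / 2\<close> up to a geometric error.\<close>
  define s where "s = (1 - c) * r / 2"
  have "0 < s" using assms c by (simp add: s_def)
  define p where "p = measure noise_law (cball 0 (s / h))"
  have p: "0 < p" unfolding p_def using \<open>0 < s\<close> h_pos by (intro small_noise) simp
  \<comment> \<open>The solution of \<open>b (Suc t) = c * b t + s\<close> with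
    \<open>b 0 = R + r / 2\<close>. It starts above the bound on the state space and falls below
    \<open>r\<close> after a number of steps independent of the starting point.\<close>
  define b where "b t = c ^ t * R + r / 2" for t :: nat
  have step: "p \<le> measure (step_kernel y) (cball 0 (b (Suc t)))" if "y \<in> states" "y \<in> cball 0 (b t)" for y t
  proof -
    have "measure noise_law (cball 0 (s / h)) \<le> measure noise_law {v. norm (drift y + h *\<^sub>R v) \<le> b (Suc t)}"
    proof (rule finite_measure.finite_measure_mono[OF prob_space.axioms(1)[OF prob_space_noise_law]])
      show "cball 0 (s / h) \<subseteq> {v. norm (drift y + h *\<^sub>R v) \<le> b (Suc t)}"
      proof
        fix v :: "('n, 'd) state" assume "v \<in> cball 0 (s / h)"
        then have "h * norm v \<le> s" using h_pos by (simp add: field_simps)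
        have "norm (drift y + h *\<^sub>R v) \<le> norm (drift y) + h * norm v"
          using norm_triangle_ineq[of "drift y" "h *\<^sub>R v"] h_pos by simp
        also have "\<dots> \<le> c * b t + s"
          using c(3)[OF that(1)] mult_left_mono[OF _ c(1), of "norm y" "b t"] that(2) \<open>h * norm v \<le> s\<close> by simp
        also have "\<dots> = b (Suc t)"
          by (simp add: b_def s_def algebra_simps) (simp add: field_simps)
        finally show "v \<in> {v. norm (drift y + h *\<^sub>R v) \<le> b (Suc t)}" by simp
      qed
    qed measurable
    also have "\<dots> = measure (step_kernel y) (cball 0 (b (Suc t)))"
      unfolding step_kernel_def
      by (subst measure_distr) (auto simp: sets_eq_imp_space_eq[OF sets_noise_law] intro!: arg_cong[where f="measure _"])
    finally show ?thesis by (simp add: p_def)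
  qed
  have lower: "p ^ t \<le> measure (P t x) (cball 0 (b t))" if x: "x \<in> states" for x t
  proof (induction t)
    case 0
    have "x \<in> cball 0 (b 0)" using R(2)[OF x] assms by (simp add: b_def)
    then show ?case by (simp add: transition_0 measure_return)
  next
    case (Suc t)
    have "p ^ Suc t \<le> p * measure (P t x) (cball 0 (b t))"
      using Suc p by simp
    also have "\<dots> \<le> measure (P (Suc t) x) (cball 0 (b (Suc t)))"
      by (rule transition_Suc_ge[OF x]) (auto intro: step)
    finally show ?case .
  qed
  have "(\<lambda>t. c ^ t * R) \<longlonglongrightarrow> 0"
    using c by (intro tendsto_mult_left_zero LIMSEQ_power_zero) simp
  then have "\<forall>\<^sub>F t in sequentially. c ^ t * R < r / 2"
    using assms by (intro order_tendstoD(2)) auto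
  then obtain m where m: "c ^ m * R < r / 2"
    by (auto simp: eventually_sequentially)
  show thesis
  proof
    show "0 < p ^ m" using p by simp
    fix x assume x: "x \<in> states"
    have "p ^ m \<le> measure (P m x) (cball 0 (b m))" by (rule lower[OF x])
    also have "\<dots> \<le> measure (P m x) (cball 0 r)"
      using m by (intro finite_measure.finite_measure_mono[OF prob_space.axioms(1)[OF prob_space_transition]])
        (auto simp: b_def)
    finally show "p ^ m \<le> measure (P m x) (cball 0 r)" .
  qed
qed

theorem geometrically_ergodic_states: "geometrically_ergodic states P"
proof -
  obtain c where c: "0 \<le> c" "c < 1" "\<And>y. y \<in> states \<Longrightarrow> norm (drift y) \<le> c * norm y"
    using drift_contracting by blast
  obtain q r z where q: "0 < q" "0 < r"
    and kernel: "\<And>y A. y \<in> consensus\<^sup>\<bottom> \<Longrightarrow> norm (drift y) \<le> r \<Longrightarrow> A \<in> sets borel \<Longrightarrow>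
      q * measure lborel (ball z r \<inter> disagreement -` A) \<le> measure (step_kernel y) A"
    using step_kernel_minorization by blast
  obtain m p where p: "0 < p" "\<And>x. x \<in> states \<Longrightarrow> p \<le> measure (P m x) (cball 0 r)"
    using transition_near_zero[OF q(2)] by blast
  \<comment> \<open>The constant \<open>q * p\<close> already gives a minorization; halving it
    forces the total mass of \<open>\<nu>\<close> down to at most 1/2, as
    \<open>doeblin_geometrically_ergodic\<close> needs a mass strictly below 1.\<close>
  define e where "e = q * p / 2"
  have e: "0 < e" using p q by (simp add: e_def)
  define \<nu> where "\<nu> = distr (density lborel (\<lambda>x. ennreal e * indicator (ball z r) x)) borel disagreement"
  have sets_\<nu>[simp]: "sets \<nu> = sets borel" by (simp add: \<nu>_def)
  have emeasure_\<nu>: "emeasure \<nu> A = ennreal (e * measure lborel (ball z r \<inter> disagreement -` A))" if A: "A \<in> sets borel" for A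
  proof -
    have B: "disagreement -` A \<in> sets (borel :: ('n, 'd) state measure)"
      using measurable_sets[OF measurable_disagreement A] by simp
    have "emeasure \<nu> A = (\<integral>\<^sup>+ x. ennreal e * indicator (ball z r) x * indicator (disagreement -` A) x \<partial>lborel)"
    proof -
      have "emeasure \<nu> A = emeasure (density lborel (\<lambda>x. ennreal e * indicator (ball z r) x)) (disagreement -` A)"
        unfolding \<nu>_def using A by (subst emeasure_distr) auto
      also have "\<dots> = (\<integral>\<^sup>+ x. ennreal e * indicator (ball z r) x * indicator (disagreement -` A) x \<partial>lborel)"
        using B by (intro emeasure_density borel_measurable_times_ennreal borel_measurable_indicator) auto
      finally show ?thesis .
    qed
    also have "\<dots> = (\<integral>\<^sup>+ x. ennreal e * indicator (ball z r \<inter> disagreement -` A) x \<partial>lborel)"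
      by (simp add: indicator_inter_arith mult.assoc)
    also have "\<dots> = ennreal e * emeasure lborel (ball z r \<inter> disagreement -` A)"
      using B by (intro nn_integral_cmult_indicator) auto
    also have "emeasure lborel (ball z r \<inter> disagreement -` A) = ennreal (measure lborel (ball z r \<inter> disagreement -` A))"
    proof (rule emeasure_eq_ennreal_measure)
      have "emeasure lborel (ball z r \<inter> disagreement -` A) \<le> emeasure lborel (ball z r)"
        by (intro emeasure_mono) auto
      then show "emeasure lborel (ball z r \<inter> disagreement -` A) \<noteq> \<top>"
        using emeasure_lborel_ball_finite[of z r] by (auto simp: top_unique)
    qed
    finally show ?thesis using e by (simp add: ennreal_mult')
  qed
  have fin: "finite_measure \<nu>"
    using emeasure_\<nu>[of UNIV] sets_eq_imp_space_eq[OF sets_\<nu>] by (intro finite_measureI) simp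
  have measure_\<nu>: "measure \<nu> A = e * measure lborel (ball z r \<inter> disagreement -` A)" if "A \<in> sets borel" for A
    using emeasure_\<nu>[OF that] e by (simp add: measure_def)
  have minor: "2 * measure \<nu> A \<le> measure (P (Suc m) x) A" if x: "x \<in> states" and A: "A \<in> sets borel" for x A
  proof -
    define a where "a = q * measure lborel (ball z r \<inter> disagreement -` A)"
    have "0 \<le> a" using q by (simp add: a_def)
    have "2 * measure \<nu> A = a * p"
      by (simp add: measure_\<nu>[OF A] e_def a_def)
    also have "\<dots> \<le> a * measure (P m x) (cball 0 r)"
      using p(2)[OF x] \<open>0 \<le> a\<close> by (rule mult_left_mono)
    also have "\<dots> \<le> measure (P (Suc m) x) A"
    proof (rule transition_Suc_ge[OF x A])
      fix y assume y: "y \<in> states" "y \<in> cball 0 r"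
      \<comment> \<open>Contraction carries the bound \<open>r\<close> from \<open>y\<close> over to
        \<open>drift y\<close>, which is what \<open>kernel\<close> asks for.\<close>
      have "norm (drift y) \<le> c * norm y" by (rule c(3)[OF y(1)])
      also have "\<dots> \<le> r"
        using c(1,2) y(2) mult_left_le_one_le[of "norm y" c] by simp
      finally show "a \<le> measure (step_kernel y) A"
        unfolding a_def using y(1) states_orthogonal A by (intro kernel) auto
    qed simp
    finally show ?thesis .
  qed
  show ?thesis
  proof (rule doeblin_geometrically_ergodic[where \<nu>=\<nu> and m="Suc m"])
    show "0 < measure \<nu> (space \<nu>)"
      using e q(2) sets_eq_imp_space_eq[OF sets_\<nu>] content_ball_pos[of r z] by (simp add: measure_\<nu>)
    obtain x where x: "x \<in> states" using states_nonempty by blast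
    have "2 * measure \<nu> UNIV \<le> 1"
      using minor[OF x, of UNIV] prob_space.prob_le_1[OF prob_space_transition, of "Suc m" x UNIV] by simp
    then show "measure \<nu> (space \<nu>) < 1"
      using sets_eq_imp_space_eq[OF sets_\<nu>] by simp
    show "measure \<nu> A \<le> measure (P (Suc m) x) A" if "x \<in> states" "A \<in> sets borel" for x A
      using minor[OF that] measure_nonneg[of \<nu> A] by linarith
  qed (auto simp: states_nonempty fin transition_add AE_transition_states)
qed

end

theorem theorem1:
  fixes M :: "'a measure"
    and h S\<^sub>0 R\<^sub>0 W :: real
    and k :: "'n::finite \<Rightarrow> 'n \<Rightarrow> real"
    and \<phi> :: "real \<Rightarrow> real"
    and \<Sigma> :: "real ^ 'd::finite ^ 'd"
    and x0 :: "'a \<Rightarrow> ('n, 'd) state"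
    and w :: "nat \<Rightarrow> 'a \<Rightarrow> ('n, 'd) state"
  assumes prob: "prob_space M"
    and h_pos: "h > 0"
    and k_nonneg: "\<And>i j. k i j \<ge> 0"
    and x0_rv: "x0 \<in> borel_measurable M"
    and x0_iid: "iid M (\<lambda>i \<omega>. agent (x0 \<omega>) i)"
    and x0_bounded: "AE \<omega> in M. norm (x0 \<omega>) \<le> R\<^sub>0"
    and w_iid: "iid M w"
    and w_entries_iid: "\<And>t. iid M (\<lambda>i \<omega>. agent (w t \<omega>) i)"
    and w_indep_state: "\<And>t. prob_space.indep_var M borel (w t) borel (\<lambda>\<omega>. network h k \<phi> (x0 \<omega>) (\<lambda>s. w s \<omega>) t)"
    and w_mean: "\<And>t. (LINT \<omega>|M. w t \<omega>) = 0"
    and w_covariance: "\<And>t. (LINT \<omega>|M. (\<chi> p q. w t \<omega> $ p * w t \<omega> $ q)) = kron (mat 1) \<Sigma>"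
    and W_pos: "W > 0"
    and w_bounded: "\<And>t. AE \<omega> in M. norm (w t \<omega>) \<le> W"
    and w_density: "\<And>t. \<exists>f. (\<forall>z. 0 \<le> f z) \<and> lower_semicontinuous f \<and>
               distributed M lborel (w t) (\<lambda>z. ennreal (f z))"
    and phi_pos: "\<And>r. r \<ge> 0 \<Longrightarrow> \<phi> r > 0"
    and phi_continuous: "continuous_on {0..} \<phi>"
    and phi_differentiable: "\<phi> differentiable (at 0 within {0..})"
    and S0_pos: "S\<^sub>0 > 0"
    and phi_bounded: "\<And>r. r \<ge> 0 \<Longrightarrow> \<phi> r \<le> S\<^sub>0"
    and undirected: "\<And>i j. k i j = k j i"
    and simple: "irrefl (interaction_graph k)"
    and connected: "\<And>i j. (i, j) \<in> (interaction_graph k)\<^sup>*"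
    and lambda_max_bound: "\<And>x t. x \<in> trajectories M h k \<phi> x0 w \<Longrightarrow> lambda_max (laplacian k \<phi> (x t)) < 2 / h"
    and zeta_less_1: "(SUP (x, t) \<in> trajectories M h k \<phi> x0 w \<times> UNIV.
            max \<bar>1 - h * lambda_2 (laplacian k \<phi> (x t))\<bar>
                \<bar>1 - h * lambda_max (laplacian k \<phi> (x t))\<bar>) < 1"
  shows "geometrically_ergodic (state_space M h k \<phi> x0 w) (transition M h k \<phi> w)"
proof -
  interpret coupling h S\<^sub>0 k \<phi>
    by (rule coupling.intro) (fact h_pos k_nonneg phi_pos phi_continuous phi_bounded undirected simple connected)+
  interpret noisy_coupling M h S\<^sub>0 k \<phi> R\<^sub>0 W x0 w
    by (intro noisy_coupling.intro coupling_axioms prob noisy_coupling_axioms.intro)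
      (fact x0_rv x0_bounded w_iid w_entries_iid w_bounded w_density zeta_less_1)+
  show ?thesis
    by (rule geometrically_ergodic_states)
qed

end
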